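(* Let $G$ be a discrete amenable group, let $A$ be a $\mathrm{C}^\ast$-algebra that is commutative (not necessarily unital) or finite dimensional, and let $\alpha: G\to \mathrm{Aut}(A)$ be an action of $G$ on $A$ by $^\ast$-automorphisms. Then the crossed product Banach algebra $\ell^1(G,A;\alpha)$ is an amenable Banach algebra.
   Context: A $\mathrm{C}^\ast$-dynamical system $(A,G,\alpha)$ with $G$ discrete consists of a $\mathrm{C}^\ast$-algebra $A$, a discrete group $G$, and a group homomorphism $\alpha: G\to\mathrm{Aut}(A)$, $g\mapsto\alpha_g$, into the group of $^\ast$-automorphisms of $A$. The algebra $\ell^1(G,A;\alpha)$ is the set of all maps $\mathtt{a}: G\to A$, $g\mapsto a_g$, such that $\Vert \mathtt{a}\Vert:=\sum_{g\in G}\Vert a_g\Vert<\infty$, with pointwise linear operations, this norm, the twisted convolution product $(\mathtt{a}\mathtt{a}')(g)=\sum_{k\in G}a_k\cdot\alpha_k(a'_{k^{-1}g})$, and the involution $(\mathtt{a}^\ast)(g)=\alpha_g((a_{g^{-1}})^\ast)$. It is a Banach algebra with isometric involution. A discrete group $G$ is amenable if there exists a left invariant mean on $\ell^\infty(G)$. A Banach algebra $B$ is amenable if every bounded derivation $D: B\to E^\ast$ from $B$ into the dual of any Banach $B$-bimodule $E$ is inner, i.e. there exists $x^\ast\in E^\ast$ such that $D(b)=b\cdot x^\ast-x^\ast\cdot b$ for all $b\in B$. Here $E^\ast$ carries the usual dual bimodule structure $(b\cdot x^\ast)(x)=x^\ast(x\cdot b)$, $(x^\ast\cdot b)(x)=x^\ast(b\cdot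 x)$. *)

theory Defs
  imports "HOL-Analysis.Analysis"
begin

class complex_banach = banach +
  fixes scaleC :: "complex \<Rightarrow> 'a \<Rightarrow> 'a"  (infixr "*\<^sub>C" 75)
  assumes scaleC_add_right: "c *\<^sub>C (x + y) = c *\<^sub>C x + c *\<^sub>C y"
    and scaleC_add_left: "(c + d) *\<^sub>C x = c *\<^sub>C x + d *\<^sub>C x"
    and scaleC_scaleC: "c *\<^sub>C d *\<^sub>C x = (c * d) *\<^sub>C x"
    and scaleC_of_real: "of_real r *\<^sub>C x = r *\<^sub>R x"
    and norm_scaleC: "norm (c *\<^sub>C x) = cmod c * norm x"

global_interpretation complex_vec: vector_space "scaleC :: complex \<Rightarrow> 'a \<Rightarrow> 'a::complex_banach"
  defines cspan = complex_vec.span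
proof
  show "1 *\<^sub>C x = x" for x :: 'a
    using scaleC_of_real [of 1 x] by simp
qed (simp_all add: scaleC_add_right scaleC_add_left scaleC_scaleC)

text \<open>No unit is required.\<close>

class cstar_algebra = real_normed_algebra + complex_banach +
  fixes star :: "'a \<Rightarrow> 'a"
  assumes scaleC_mult_left: "(c *\<^sub>C x) * y = c *\<^sub>C (x * y)"
    and scaleC_mult_right: "x * (c *\<^sub>C y) = c *\<^sub>C (x * y)"
    and star_star: "star (star x) = x"
    and star_add: "star (x + y) = star x + star y"
    and star_scaleC: "star (c *\<^sub>C x) = cnj c *\<^sub>C star x"
    and star_mult: "star (x * y) = star y * star x"
    and norm_star_mult: "norm (star x * x) = (norm x)\<^sup>2"

instantiation complex :: cstar_algebra
begin
definition scaleC_complex_def: "scaleC c (z::complex) = c * z"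
definition star_complex_def: "star (z::complex) = cnj z"
instance
  by standard
    (simp_all add: scaleC_complex_def star_complex_def algebra_simps scaleR_conv_of_real
      norm_mult power2_eq_square)
end

definition star_automorphism :: "('a::cstar_algebra \<Rightarrow> 'a) \<Rightarrow> bool" where
  "star_automorphism \<phi> \<longleftrightarrow>
     bij \<phi> \<and>
     (\<forall>x y. \<phi> (x + y) = \<phi> x + \<phi> y) \<and>
     (\<forall>c x. \<phi> (c *\<^sub>C x) = c *\<^sub>C \<phi> x) \<and>
     (\<forall>x y. \<phi> (x * y) = \<phi> x * \<phi> y) \<and>
     (\<forall>x. \<phi> (star x) = star (\<phi> x))"

text \<open>
  Discrete groups are types of class \<^class>\<open>group_add\<close>, that is, groups, not necessarily
  commutative, in additive notation: \<open>g + h\<close> stands for the product and \<open>- g\<close> for the inverse.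
\<close>

definition cstar_action :: "('g::group_add \<Rightarrow> 'a::cstar_algebra \<Rightarrow> 'a) \<Rightarrow> bool" where
  "cstar_action \<alpha> \<longleftrightarrow>
     (\<forall>g. star_automorphism (\<alpha> g)) \<and> (\<forall>g h. \<alpha> (g + h) = \<alpha> g \<circ> \<alpha> h)"

definition linf :: "('g \<Rightarrow> complex) set" where
  "linf = {f. bounded (range f)}"

text \<open>A mean is a linear functional with norm one that takes the value one at the constant
  function one.  Only the values of \<open>m\<close> on \<^const>\<open>linf\<close> matter.\<close>

definition is_mean :: "(('g \<Rightarrow> complex) \<Rightarrow> complex) \<Rightarrow> bool" where
  "is_mean m \<longleftrightarrow>
     (\<forall>f\<in>linf. \<forall>f'\<in>linf. m (\<lambda>h. f h + f' h) = m f + m f') \<and>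
     (\<forall>c. \<forall>f\<in>linf. m (\<lambda>h. c * f h) = c * m f) \<and>
     (\<forall>f\<in>linf. cmod (m f) \<le> (SUP h. cmod (f h))) \<and>
     m (\<lambda>h. 1) = 1"

definition left_invariant :: "(('g::group_add \<Rightarrow> complex) \<Rightarrow> complex) \<Rightarrow> bool" where
  "left_invariant m \<longleftrightarrow> (\<forall>g. \<forall>f\<in>linf. m (\<lambda>h. f (- g + h)) = m f)"

definition amenable_group :: "'g::group_add itself \<Rightarrow> bool" where
  "amenable_group _ \<longleftrightarrow>
     (\<exists>m :: ('g \<Rightarrow> complex) \<Rightarrow> complex. is_mean m \<and> left_invariant m)"

text \<open>
  The algebra \<open>\<ell>\<^sup>1(G,A;\<alpha>)\<close> depends on the action \<open>\<alpha>\<close>, which is a term, so it cannot be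
  a type; Banach algebras are therefore given by a carrier set and operations on it.
\<close>

record 'b normed_alg =
  na_carrier :: "'b set"
  na_zero :: 'b
  na_add :: "'b \<Rightarrow> 'b \<Rightarrow> 'b"
  na_scale :: "complex \<Rightarrow> 'b \<Rightarrow> 'b"
  na_mult :: "'b \<Rightarrow> 'b \<Rightarrow> 'b"
  na_norm :: "'b \<Rightarrow> real"

definition na_diff :: "'b normed_alg \<Rightarrow> 'b \<Rightarrow> 'b \<Rightarrow> 'b" where
  "na_diff B a b = na_add B a (na_scale B (-1) b)"

locale banach_algebra =
  fixes B :: "'b normed_alg"
  assumes zero_closed: "na_zero B \<in> na_carrier B"
    and add_closed: "a \<in> na_carrier B \<Longrightarrow> b \<in> na_carrier B \<Longrightarrow> na_add B a b \<in> na_carrier B"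
    and scale_closed: "a \<in> na_carrier B \<Longrightarrow> na_scale B c a \<in> na_carrier B"
    and mult_closed: "a \<in> na_carrier B \<Longrightarrow> b \<in> na_carrier B \<Longrightarrow> na_mult B a b \<in> na_carrier B"
    and add_assoc: "a \<in> na_carrier B \<Longrightarrow> b \<in> na_carrier B \<Longrightarrow> d \<in> na_carrier B \<Longrightarrow>
      na_add B (na_add B a b) d = na_add B a (na_add B b d)"
    and add_commute: "a \<in> na_carrier B \<Longrightarrow> b \<in> na_carrier B \<Longrightarrow> na_add B a b = na_add B b a"
    and add_zero: "a \<in> na_carrier B \<Longrightarrow> na_add B a (na_zero B) = a"
    and diff_self: "a \<in> na_carrier B \<Longrightarrow> na_diff B a a = na_zero B"
    and scale_add_right: "a \<in> na_carrier B \<Longrightarrow> b \<in> na_carrier B \<Longrightarrow>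
      na_scale B c (na_add B a b) = na_add B (na_scale B c a) (na_scale B c b)"
    and scale_add_left: "a \<in> na_carrier B \<Longrightarrow>
      na_scale B (c + c') a = na_add B (na_scale B c a) (na_scale B c' a)"
    and scale_scale: "a \<in> na_carrier B \<Longrightarrow> na_scale B c (na_scale B c' a) = na_scale B (c * c') a"
    and scale_one: "a \<in> na_carrier B \<Longrightarrow> na_scale B 1 a = a"
    and mult_assoc: "a \<in> na_carrier B \<Longrightarrow> b \<in> na_carrier B \<Longrightarrow> d \<in> na_carrier B \<Longrightarrow>
      na_mult B (na_mult B a b) d = na_mult B a (na_mult B b d)"
    and mult_add_left: "a \<in> na_carrier B \<Longrightarrow> b \<in> na_carrier B \<Longrightarrow> d \<in> na_carrier B \<Longrightarrow>
      na_mult B (na_add B a b) d = na_add B (na_mult B a d) (na_mult B b d)"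
    and mult_add_right: "a \<in> na_carrier B \<Longrightarrow> b \<in> na_carrier B \<Longrightarrow> d \<in> na_carrier B \<Longrightarrow>
      na_mult B a (na_add B b d) = na_add B (na_mult B a b) (na_mult B a d)"
    and mult_scale_left: "a \<in> na_carrier B \<Longrightarrow> b \<in> na_carrier B \<Longrightarrow>
      na_mult B (na_scale B c a) b = na_scale B c (na_mult B a b)"
    and mult_scale_right: "a \<in> na_carrier B \<Longrightarrow> b \<in> na_carrier B \<Longrightarrow>
      na_mult B a (na_scale B c b) = na_scale B c (na_mult B a b)"
    and norm_nonneg: "a \<in> na_carrier B \<Longrightarrow> 0 \<le> na_norm B a"
    and norm_eq_zero: "a \<in> na_carrier B \<Longrightarrow> na_norm B a = 0 \<longleftrightarrow> a = na_zero B"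
    and norm_triangle: "a \<in> na_carrier B \<Longrightarrow> b \<in> na_carrier B \<Longrightarrow>
      na_norm B (na_add B a b) \<le> na_norm B a + na_norm B b"
    and norm_scale: "a \<in> na_carrier B \<Longrightarrow> na_norm B (na_scale B c a) = cmod c * na_norm B a"
    and norm_mult: "a \<in> na_carrier B \<Longrightarrow> b \<in> na_carrier B \<Longrightarrow>
      na_norm B (na_mult B a b) \<le> na_norm B a * na_norm B b"
    and complete:
      "(\<And>n::nat. s n \<in> na_carrier B) \<Longrightarrow>
       (\<And>e. 0 < e \<Longrightarrow> \<exists>N. \<forall>m\<ge>N. \<forall>n\<ge>N. na_norm B (na_diff B (s m) (s n)) < e) \<Longrightarrow>
       \<exists>a\<in>na_carrier B. (\<lambda>n. na_norm B (na_diff B (s n) a)) \<longlonglongrightarrow> 0"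

text \<open>Here \<open>l b x\<close> is \<open>b \<cdot> x\<close> and \<open>r x b\<close> is \<open>x \<cdot> b\<close>.\<close>

locale banach_bimodule = banach_algebra B
  for B :: "'b normed_alg" +
  fixes l :: "'b \<Rightarrow> 'e::complex_banach \<Rightarrow> 'e" and r :: "'e \<Rightarrow> 'b \<Rightarrow> 'e"
  assumes l_add: "b \<in> na_carrier B \<Longrightarrow> l b (x + y) = l b x + l b y"
    and l_scale: "b \<in> na_carrier B \<Longrightarrow> l b (c *\<^sub>C x) = c *\<^sub>C l b x"
    and l_na_add: "a \<in> na_carrier B \<Longrightarrow> b \<in> na_carrier B \<Longrightarrow> l (na_add B a b) x = l a x + l b x"
    and l_na_scale: "b \<in> na_carrier B \<Longrightarrow> l (na_scale B c b) x = c *\<^sub>C l b x"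
    and l_na_mult: "a \<in> na_carrier B \<Longrightarrow> b \<in> na_carrier B \<Longrightarrow> l (na_mult B a b) x = l a (l b x)"
    and r_add: "b \<in> na_carrier B \<Longrightarrow> r (x + y) b = r x b + r y b"
    and r_scale: "b \<in> na_carrier B \<Longrightarrow> r (c *\<^sub>C x) b = c *\<^sub>C r x b"
    and r_na_add: "a \<in> na_carrier B \<Longrightarrow> b \<in> na_carrier B \<Longrightarrow> r x (na_add B a b) = r x a + r x b"
    and r_na_scale: "b \<in> na_carrier B \<Longrightarrow> r x (na_scale B c b) = c *\<^sub>C r x b"
    and r_na_mult: "a \<in> na_carrier B \<Longrightarrow> b \<in> na_carrier B \<Longrightarrow> r x (na_mult B a b) = r (r x a) b"
    and l_r: "a \<in> na_carrier B \<Longrightarrow> b \<in> na_carrier B \<Longrightarrow> r (l a x) b = l a (r x b)"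
    and l_bounded: "\<exists>K. \<forall>b\<in>na_carrier B. \<forall>x. norm (l b x) \<le> K * na_norm B b * norm x"
    and r_bounded: "\<exists>K. \<forall>b\<in>na_carrier B. \<forall>x. norm (r x b) \<le> K * na_norm B b * norm x"

text \<open>The norm of the dual space is \<^const>\<open>onorm\<close>.\<close>

definition dual_space :: "('e::complex_banach \<Rightarrow> complex) set" where
  "dual_space = {\<phi>. bounded_linear \<phi> \<and> (\<forall>c x. \<phi> (c *\<^sub>C x) = c * \<phi> x)}"

definition dual_left :: "('e \<Rightarrow> 'b \<Rightarrow> 'e) \<Rightarrow> 'b \<Rightarrow> ('e \<Rightarrow> complex) \<Rightarrow> 'e \<Rightarrow> complex" where
  "dual_left r b \<phi> = (\<lambda>x. \<phi> (r x b))"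

definition dual_right :: "('b \<Rightarrow> 'e \<Rightarrow> 'e) \<Rightarrow> ('e \<Rightarrow> complex) \<Rightarrow> 'b \<Rightarrow> 'e \<Rightarrow> complex" where
  "dual_right l \<phi> b = (\<lambda>x. \<phi> (l b x))"

definition bounded_derivation ::
  "'b normed_alg \<Rightarrow> ('b \<Rightarrow> 'e::complex_banach \<Rightarrow> 'e) \<Rightarrow> ('e \<Rightarrow> 'b \<Rightarrow> 'e) \<Rightarrow>
   ('b \<Rightarrow> 'e \<Rightarrow> complex) \<Rightarrow> bool" where
  "bounded_derivation B l r D \<longleftrightarrow>
     (\<forall>b\<in>na_carrier B. D b \<in> dual_space) \<and>
     (\<forall>a\<in>na_carrier B. \<forall>b\<in>na_carrier B. D (na_add B a b) = (\<lambda>x. D a x + D b x)) \<and>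
     (\<forall>c. \<forall>b\<in>na_carrier B. D (na_scale B c b) = (\<lambda>x. c * D b x)) \<and>
     (\<exists>K. \<forall>b\<in>na_carrier B. onorm (D b) \<le> K * na_norm B b) \<and>
     (\<forall>a\<in>na_carrier B. \<forall>b\<in>na_carrier B.
        D (na_mult B a b) = (\<lambda>x. dual_left r a (D b) x + dual_right l (D a) b x))"

definition inner_derivation ::
  "'b normed_alg \<Rightarrow> ('b \<Rightarrow> 'e::complex_banach \<Rightarrow> 'e) \<Rightarrow> ('e \<Rightarrow> 'b \<Rightarrow> 'e) \<Rightarrow>
   ('b \<Rightarrow> 'e \<Rightarrow> complex) \<Rightarrow> bool" where
  "inner_derivation B l r D \<longleftrightarrow>
     (\<exists>\<phi>\<in>dual_space. \<forall>b\<in>na_carrier B.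
        D b = (\<lambda>x. dual_left r b \<phi> x - dual_right l \<phi> b x))"

text \<open>
  A formula cannot quantify over the types \<open>'e\<close> underlying the bimodules, so \<open>'e\<close> is a
  parameter: \<open>B\<close> is amenable if the following holds for every type \<open>'e\<close>, which is what a
  theorem with a type variable \<open>'e\<close> in its conclusion expresses.
\<close>

definition amenable_banach_algebra :: "'e::complex_banach itself \<Rightarrow> 'b normed_alg \<Rightarrow> bool" where
  "amenable_banach_algebra _ B \<longleftrightarrow>
     banach_algebra B \<and>
     (\<forall>(l :: 'b \<Rightarrow> 'e \<Rightarrow> 'e) r D.
        banach_bimodule B l r \<longrightarrow> bounded_derivation B l r D \<longrightarrow> inner_derivation B l r D)"

definition l1_algebra ::
  "('g::group_add \<Rightarrow> 'a::cstar_algebra \<Rightarrow> 'a) \<Rightarrow> ('g \<Rightarrow> 'a) normed_alg" where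
  "l1_algebra \<alpha> =
     \<lparr> na_carrier = {a. (\<lambda>g. norm (a g)) summable_on UNIV},
       na_zero = (\<lambda>g. 0),
       na_add = (\<lambda>a b g. a g + b g),
       na_scale = (\<lambda>c a g. c *\<^sub>C a g),
       na_mult = (\<lambda>a b g. \<Sum>\<^sub>\<infinity>k. a k * \<alpha> k (b (- k + g))),
       na_norm = (\<lambda>a. \<Sum>\<^sub>\<infinity>g. norm (a g)) \<rparr>"

end

theory Submission
  imports Defs
begin

text \<open>
  A virtual diagonal of \<open>B\<close> turns every bounded derivation into a dual module into an inner one,
  without approximate identities or essential modules. A left invariant mean on \<open>G\<close> averages the
  translates \<open>\<delta>\<^sub>g a \<otimes> b \<delta>\<^sub>g\<^sup>-\<^sup>1\<close> of a virtual diagonal of \<open>A\<close> to one of \<open>\<ell>\<^sup>1(G,A;\<alpha>)\<close>, so only \<open>A\<close> itself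
  has to be treated. If \<open>A\<close> is commutative, the unitaries of the form \<open>1 + s\<close>, \<open>s \<in> A\<close>, of its
  unitization form an abelian group, hence carry an invariant mean by Markov--Kakutani; they span
  \<open>A\<close> up to constants, so the mean of \<open>(1 + s) \<otimes> (1 + s)\<^sup>*\<close> is a virtual diagonal of the unitization,
  and \<open>- s\<close> is, in the mean, an approximate identity that brings it back into \<open>A\<close>. If \<open>A\<close> is finite
  dimensional, the trace form of the regular representation is nondegenerate and its Casimir
  element is a diagonal.
\<close>

section \<open>Invariant means\<close>

text \<open>The two hypotheses on A call for different diagonals. Averaging over unitaries requires
  an invariant mean on them as a discrete group; for a noncommutative algebra such as the 2 by 2
  matrices the unitary group contains free subgroups and has no such mean, whence the algebraic
  Casimir element. The unitization is never formed: a unitary is represented by its difference s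
  from 1, and multiplication by it is written \<open>x + s * x\<close>. Another obstacle precedes
  any diagonal: \<open>star_automorphism\<close> says nothing about norms, yet already the
  convergence of the convolution rests on contractivity of the \<open>\<alpha> g\<close>. The same
  unitaries supply it and replace spectral theory: up to sign, selfadjoint elements of norm below 1
  are imaginary parts of unitaries, and automorphisms preserve unitaries. On the group side,
  identities that would demand rearranging sums are checked on point masses, whose span is
  dense.\<close>

definition mean_on :: "'x set \<Rightarrow> (('x \<Rightarrow> complex) \<Rightarrow> complex) \<Rightarrow> bool" where
  "mean_on X \<Lambda> \<longleftrightarrow>
     (\<forall>f f'. bounded (f ` X) \<longrightarrow> bounded (f' ` X) \<longrightarrow> \<Lambda> (\<lambda>x. f x + f' x) = \<Lambda> f + \<Lambda> f') \<and>
     (\<forall>c f. bounded (f ` X) \<longrightarrow> \<Lambda> (\<lambda>x. c * f x) = c * \<Lambda> f) \<and>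
     (\<forall>f K. (\<forall>x\<in>X. cmod (f x) \<le> K) \<longrightarrow> cmod (\<Lambda> f) \<le> K) \<and>
     \<Lambda> (\<lambda>x. 1) = 1"

lemma mean_onD:
  assumes "mean_on X \<Lambda>"
  shows mean_on_add: "bounded (f ` X) \<Longrightarrow> bounded (f' ` X) \<Longrightarrow> \<Lambda> (\<lambda>x. f x + f' x) = \<Lambda> f + \<Lambda> f'"
    and mean_on_scale: "bounded (f ` X) \<Longrightarrow> \<Lambda> (\<lambda>x. c * f x) = c * \<Lambda> f"
    and mean_on_bound: "(\<And>x. x \<in> X \<Longrightarrow> cmod (f x) \<le> K) \<Longrightarrow> cmod (\<Lambda> f) \<le> K"
    and mean_on_one: "\<Lambda> (\<lambda>x. 1) = 1"
  using assms unfolding mean_on_def by blast+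

lemma mean_on_const: "mean_on X \<Lambda> \<Longrightarrow> \<Lambda> (\<lambda>x. c) = c"
  using mean_on_scale [of X \<Lambda> "\<lambda>_. 1" c] mean_on_one [of X \<Lambda>]
  by (simp add: image_constant_conv)

lemma mean_on_diff:
  assumes "mean_on X \<Lambda>" "bounded (f ` X)" "bounded (f' ` X)"
  shows "\<Lambda> (\<lambda>x. f x - f' x) = \<Lambda> f - \<Lambda> f'"
proof -
  have "bounded ((\<lambda>x. -1 * f' x) ` X)"
    using assms(3) by (auto simp: bounded_iff)
  then have "\<Lambda> (\<lambda>x. f x + -1 * f' x) = \<Lambda> f + -1 * \<Lambda> f'"
    by (simp only: mean_on_add [OF assms(1,2)] mean_on_scale [OF assms(1,3)])
  then show ?thesis
    by simp
qed

text \<open>A mean is a functional on total functions, yet it sees only their restriction to X: the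
  bound clause of \<open>mean_on\<close> applies with \<open>K = 0\<close> to the
  difference.\<close>

lemma mean_on_cong:
  assumes "mean_on X \<Lambda>" "bounded (f ` X)" "\<And>x. x \<in> X \<Longrightarrow> f x = f' x"
  shows "\<Lambda> f = \<Lambda> f'"
proof -
  have b: "bounded (f' ` X)"
    using assms(2,3) by (metis image_cong)
  have "cmod (\<Lambda> (\<lambda>x. f x - f' x)) \<le> 0"
    by (rule mean_on_bound [OF assms(1)]) (simp add: assms(3))
  then show ?thesis
    using mean_on_diff [OF assms(1,2) b] by simp
qed

section \<open>Means invariant under commuting maps\<close>

lemma bounded_image_add:
  fixes f f' :: "'x \<Rightarrow> 'v::real_normed_vector"
  assumes "bounded (f ` X)" "bounded (f' ` X)"
  shows "bounded ((\<lambda>x. f x + f' x) ` X)"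
proof -
  obtain a b where "\<And>x. x \<in> X \<Longrightarrow> norm (f x) \<le> a" "\<And>x. x \<in> X \<Longrightarrow> norm (f' x) \<le> b"
    using assms by (auto simp: bounded_iff)
  then show ?thesis
    unfolding bounded_iff by (intro exI[of _ "a + b"]) (auto intro!: norm_triangle_mono)
qed

lemma bounded_image_scale:
  fixes f :: "'x \<Rightarrow> complex"
  assumes "bounded (f ` X)"
  shows "bounded ((\<lambda>x. c * f x) ` X)"
proof -
  obtain a where "\<And>x. x \<in> X \<Longrightarrow> cmod (f x) \<le> a"
    using assms by (auto simp: bounded_iff)
  then show ?thesis
    unfolding bounded_iff
    by (intro exI[of _ "cmod c * a"]) (auto simp: norm_mult intro!: mult_left_mono)
qed

text \<open>Banach-Alaoglu through Tychonoff: the means form a closed subset of a product of discs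
  indexed by all functions. Setting them to 0 on unbounded functions puts those coordinates into a
  compact disc as well.\<close>

lemma compact_mean_on: "compact {\<Lambda>. mean_on X \<Lambda> \<and> (\<forall>f. \<not> bounded (f ` X) \<longrightarrow> \<Lambda> f = 0)}"
proof (cases "X = {}")
  case True
  \<comment> \<open>On the empty set the bound holds even with \<open>K = -1\<close>, so no mean
    exists.\<close>
  have "\<not> mean_on X \<Lambda>" for \<Lambda>
    using mean_on_bound [of X \<Lambda> "\<lambda>_. 0" "-1"] True norm_ge_zero [of "\<Lambda> (\<lambda>_. 0)"]
    by (auto simp del: norm_ge_zero)
  then show ?thesis
    by simp
next
  case False
  define \<beta> where "\<beta> f = (if bounded (f ` X) then SUP x\<in>X. cmod (f x) else 0)" for f :: "'a \<Rightarrow> complex"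
  have "compactin (product_topology (\<lambda>f. euclidean) UNIV) (PiE UNIV (\<lambda>f. cball (0::complex) (\<beta> f)))"
    by (simp add: compactin_PiE)
  then have K: "compact (PiE UNIV (\<lambda>f. cball (0::complex) (\<beta> f)))"
    by (simp add: euclidean_product_topology)
  have sup: "cmod (f x) \<le> \<beta> f" if "x \<in> X" "bounded (f ` X)" for f x
    using that by (auto simp: \<beta>_def bounded_norm_comp intro!: cSUP_upper bounded_imp_bdd_above)
  have "{\<Lambda>. mean_on X \<Lambda> \<and> (\<forall>f. \<not> bounded (f ` X) \<longrightarrow> \<Lambda> f = 0)} =
      PiE UNIV (\<lambda>f. cball 0 (\<beta> f)) \<inter>
      {\<Lambda>. (\<forall>f f'. bounded (f ` X) \<longrightarrow> bounded (f' ` X) \<longrightarrow> \<Lambda> (\<lambda>x. f x + f' x) = \<Lambda> f + \<Lambda> f')} \<inter>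
      {\<Lambda>. \<forall>c f. bounded (f ` X) \<longrightarrow> \<Lambda> (\<lambda>x. c * f x) = c * \<Lambda> f} \<inter>
      {\<Lambda>. \<Lambda> (\<lambda>x. 1) = 1}" (is "?L = ?R")
  proof (intro equalityI subsetI)
    fix \<Lambda> assume L: "\<Lambda> \<in> ?L"
    have "cmod (\<Lambda> f) \<le> \<beta> f" for f
    proof (cases "bounded (f ` X)")
      case True
      then show ?thesis
        using L sup by (auto intro: mean_on_bound)
    qed (use L in \<open>auto simp: \<beta>_def\<close>)
    then show "\<Lambda> \<in> ?R"
      using L by (auto simp: mean_on_def)
  next
    fix \<Lambda> assume R: "\<Lambda> \<in> ?R"
    have *: "cmod (\<Lambda> f) \<le> \<beta> f" for f
      using R by (auto simp: PiE_iff)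
    have "cmod (\<Lambda> f) \<le> K" if "\<forall>x\<in>X. cmod (f x) \<le> K" for f K
    proof -
      have "bounded (f ` X)"
        using that by (auto simp: bounded_iff)
      then have "\<beta> f \<le> K"
        using that False by (auto simp: \<beta>_def intro!: cSUP_least)
      then show ?thesis
        using * order_trans by blast
    qed
    moreover have "\<Lambda> f = 0" if "\<not> bounded (f ` X)" for f
      using * [of f] that by (simp add: \<beta>_def)
    ultimately show "\<Lambda> \<in> ?L"
      using R by (auto simp: mean_on_def)
  qed
  also have "compact \<dots>"
    by (intro compact_Int_closed K closed_Collect_all closed_Collect_imp open_Collect_const
        closed_Collect_eq continuous_intros continuous_on_product_coordinates)
  finally show ?thesis .
qed

text \<open>The value 0 on unbounded functions keeps the average in the compact set of
  \<open>compact_mean_on\<close>.\<close>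

definition cesaro_mean ::
  "'x set \<Rightarrow> ('x \<Rightarrow> 'x) \<Rightarrow> (('x \<Rightarrow> complex) \<Rightarrow> complex) \<Rightarrow> nat \<Rightarrow> ('x \<Rightarrow> complex) \<Rightarrow> complex" where
  "cesaro_mean X T \<Lambda> n f = (if bounded (f ` X)
     then \<Lambda> (\<lambda>x. (1 / of_nat (Suc n)) * (\<Sum>i\<le>n. f ((T ^^ i) x))) else 0)"

text \<open>Averaging over iterates of T makes a mean T-invariant up to O(1/n), because the
  difference of the two sums telescopes to two terms, and it preserves invariance under maps that
  commute with T.\<close>

lemma cesaro_mean:
  assumes \<Lambda>: "mean_on X \<Lambda>" and T: "T ` X \<subseteq> X"
  shows "mean_on X (cesaro_mean X T \<Lambda> n)"
    and "(\<And>x. x \<in> X \<Longrightarrow> cmod (f x) \<le> K) \<Longrightarrow>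
      cmod (cesaro_mean X T \<Lambda> n (\<lambda>x. f (T x)) - cesaro_mean X T \<Lambda> n f) \<le> 2 * K / real (Suc n)"
    and "(\<And>x. T (T' x) = T' (T x)) \<Longrightarrow> T' ` X \<subseteq> X \<Longrightarrow>
      (\<And>f. bounded (f ` X) \<Longrightarrow> \<Lambda> (\<lambda>x. f (T' x)) = \<Lambda> f) \<Longrightarrow> bounded (f ` X) \<Longrightarrow>
      cesaro_mean X T \<Lambda> n (\<lambda>x. f (T' x)) = cesaro_mean X T \<Lambda> n f"
proof -
  let ?A = "cesaro_mean X T \<Lambda>"
  define S where "S n f x = (1 / of_nat (Suc n)) * (\<Sum>i\<le>n. f ((T ^^ i) x))"
    for n and f :: "'a \<Rightarrow> complex" and x
  have A: "?A n f = (if bounded (f ` X) then \<Lambda> (S n f) else 0)" for n f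
    unfolding cesaro_mean_def S_def ..
  have Ti: "(T ^^ i) x \<in> X" if "x \<in> X" for i x
    using that T by (induction i) auto
  have le: "cmod (S n f x) \<le> K" if "\<And>x. x \<in> X \<Longrightarrow> cmod (f x) \<le> K" "x \<in> X" for n f K x
  proof -
    have "cmod (\<Sum>i\<le>n. f ((T ^^ i) x)) \<le> real (card {..n}) * K"
      by (rule order.trans [OF norm_sum sum_bounded_above]) (simp add: that Ti)
    then show ?thesis
      by (simp add: S_def norm_divide field_simps flip: of_nat_Suc)
  qed
  have Sb: "bounded (S n f ` X)" if "bounded (f ` X)" for n f
    using that le by (fastforce simp: bounded_iff)
  have Sa: "S n (\<lambda>x. f x + f' x) = (\<lambda>x. S n f x + S n f' x)" for n f f'
    by (auto simp: S_def sum.distrib algebra_simps)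
  have Sc: "S n (\<lambda>x. c * f x) = (\<lambda>x. c * S n f x)" for n f c
    by (auto simp: S_def sum_distrib_left algebra_simps)
  have S1: "S n (\<lambda>x. 1) = (\<lambda>x. 1)"
    by (auto simp: S_def simp flip: of_nat_Suc)
  show "mean_on X (?A n)"
    unfolding mean_on_def
  proof (intro conjI allI impI)
    fix f K assume f: "\<forall>x\<in>X. cmod (f x) \<le> K"
    then have "bounded (f ` X)"
      by (auto simp: bounded_iff)
    then show "cmod (?A n f) \<le> K"
      using f le by (auto simp: A intro!: mean_on_bound [OF \<Lambda>])
  qed (simp_all add: A bounded_image_add bounded_image_scale image_constant_conv Sa Sc S1 Sb
      mean_on_add [OF \<Lambda>] mean_on_scale [OF \<Lambda>] mean_on_one [OF \<Lambda>])
  show "cmod (?A n (\<lambda>x. f (T x)) - ?A n f) \<le> 2 * K / real (Suc n)"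
    if f: "\<And>x. x \<in> X \<Longrightarrow> cmod (f x) \<le> K"
  proof -
    have b: "bounded (f ` X)" "bounded ((\<lambda>x. f (T x)) ` X)"
      using f T by (auto simp: bounded_iff image_subset_iff)
    have "cmod (S n (\<lambda>x. f (T x)) x - S n f x) \<le> 2 * K / real (Suc n)" if "x \<in> X" for x
    proof -
      have "(\<Sum>i\<le>n. f (T ((T ^^ i) x))) - (\<Sum>i\<le>n. f ((T ^^ i) x)) = f ((T ^^ Suc n) x) - f x"
        by (induction n) (auto simp: algebra_simps)
      then have "S n (\<lambda>x. f (T x)) x - S n f x = (f ((T ^^ Suc n) x) - f x) / of_nat (Suc n)"
        by (simp add: S_def flip: diff_divide_distrib of_nat_Suc)
      moreover have "cmod (f ((T ^^ Suc n) x) - f x) \<le> K + K"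
        by (intro order.trans [OF norm_triangle_ineq4] add_mono f Ti that)
      ultimately show ?thesis
        by (simp add: norm_divide divide_right_mono flip: of_nat_Suc)
    qed
    then have "cmod (\<Lambda> (\<lambda>x. S n (\<lambda>x. f (T x)) x - S n f x)) \<le> 2 * K / real (Suc n)"
      by (rule mean_on_bound [OF \<Lambda>])
    then show ?thesis
      using b by (simp add: A mean_on_diff [OF \<Lambda>] Sb)
  qed
  show "?A n (\<lambda>x. f (T' x)) = ?A n f"
    if comm: "\<And>x. T (T' x) = T' (T x)" and T': "T' ` X \<subseteq> X"
      and inv: "\<And>f. bounded (f ` X) \<Longrightarrow> \<Lambda> (\<lambda>x. f (T' x)) = \<Lambda> f" and f: "bounded (f ` X)"
  proof -
    have "(T ^^ i) (T' x) = T' ((T ^^ i) x)" for i x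
      by (induction i) (auto simp: comm)
    then have "S n (\<lambda>x. f (T' x)) = (\<lambda>x. S n f (T' x))"
      unfolding S_def by simp
    moreover have "bounded ((\<lambda>x. f (T' x)) ` X)"
      using f T' by (metis bounded_subset image_image image_mono)
    ultimately show ?thesis
      using f inv Sb by (simp add: A)
  qed
qed

text \<open>Compactness reduces the claim to finitely many maps, which are added one at a time:
  Cesaro averages over the new map stay invariant under the old ones, and a cluster point of them is
  invariant under the new map too.\<close>

proposition commuting_maps_mean:
  fixes V :: "('x \<Rightarrow> 'x) set"
  assumes "X \<noteq> {}" and V: "\<And>T. T \<in> V \<Longrightarrow> T ` X \<subseteq> X"
    and comm: "\<And>T T' x. T \<in> V \<Longrightarrow> T' \<in> V \<Longrightarrow> T (T' x) = T' (T x)"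
  obtains \<Lambda> where "mean_on X \<Lambda>"
    "\<And>T f. T \<in> V \<Longrightarrow> bounded (f ` X) \<Longrightarrow> \<Lambda> (\<lambda>x. f (T x)) = \<Lambda> f"
proof -
  define M where "M = {\<Lambda>. mean_on X \<Lambda> \<and> (\<forall>f. \<not> bounded (f ` X) \<longrightarrow> \<Lambda> f = 0)}"
  define I where "I T = {\<Lambda> :: ('x \<Rightarrow> complex) \<Rightarrow> complex. \<forall>f. bounded (f ` X) \<longrightarrow> \<Lambda> (\<lambda>x. f (T x)) = \<Lambda> f}"
    for T :: "'x \<Rightarrow> 'x" 
  have "compact M"
    unfolding M_def by (rule compact_mean_on)
  have clI: "closed (I T)" for T
    unfolding I_def
    by (intro closed_Collect_all closed_Collect_imp open_Collect_const
        closed_Collect_eq continuous_intros continuous_on_product_coordinates)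
  have "M \<inter> (\<Inter>T\<in>W. I T) \<noteq> {}" if "finite W" "W \<subseteq> V" for W
    using that
  proof (induction W)
    case empty
    obtain x0 where "x0 \<in> X"
      using assms(1) by blast
    then have "(\<lambda>f. if bounded (f ` X) then f x0 else 0) \<in> M"
      unfolding M_def mean_on_def
      by (auto simp: bounded_image_add bounded_image_scale image_constant_conv)
        (auto simp: bounded_iff)
    then show ?case
      by auto
  next
    case (insert T W)
    then obtain \<Lambda> where \<Lambda>: "\<Lambda> \<in> M" "\<And>T'. T' \<in> W \<Longrightarrow> \<Lambda> \<in> I T'"
      by auto
    define A where "A = cesaro_mean X T \<Lambda>"
    have m: "mean_on X \<Lambda>" "\<And>f. \<not> bounded (f ` X) \<Longrightarrow> \<Lambda> f = 0"
      using \<Lambda> by (auto simp: M_def)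
    have T: "T ` X \<subseteq> X"
      using insert.prems V by auto
    note av = cesaro_mean [OF m(1) T, folded A_def]
    have AM: "A n \<in> M \<inter> (\<Inter>T\<in>W. I T)" for n
    proof -
      have "A n \<in> M"
        using av(1) by (auto simp: M_def A_def cesaro_mean_def)
      moreover have "A n \<in> I T'" if "T' \<in> W" for T'
      proof -
        have "\<Lambda> (\<lambda>x. f (T' x)) = \<Lambda> f" if "bounded (f ` X)" for f
          using \<Lambda>(2) [OF \<open>T' \<in> W\<close>] that by (simp add: I_def)
        moreover have "T' ` X \<subseteq> X" "\<And>x. T (T' x) = T' (T x)"
          using that insert.prems V comm by blast+
        ultimately have "A n (\<lambda>x. f (T' x)) = A n f" if "bounded (f ` X)" for f
          using that by (intro av(3) [where T' = T' and f = f])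
        then show ?thesis
          by (simp add: I_def)
      qed
      ultimately show ?thesis
        by auto
    qed
    have "compact (M \<inter> (\<Inter>T\<in>W. I T))"
      using \<open>compact M\<close> by (intro compact_Int_closed closed_INT) (auto simp: clI)
    \<comment> \<open>A cluster point is taken instead of a subsequential limit, since a product
      over all functions is in general not metrizable.\<close>
    moreover have "filtermap A sequentially \<noteq> bot"
      by (simp add: filtermap_bot_iff)
    moreover have "eventually (\<lambda>\<Lambda>. \<Lambda> \<in> M \<inter> (\<Inter>T\<in>W. I T)) (filtermap A sequentially)"
      unfolding eventually_filtermap using AM by simp
    ultimately obtain \<Lambda>' where \<Lambda>': "\<Lambda>' \<in> M \<inter> (\<Inter>T\<in>W. I T)"
      "inf (nhds \<Lambda>') (filtermap A sequentially) \<noteq> bot"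
      unfolding compact_filter by blast
    have "\<Lambda>' (\<lambda>x. f (T x)) = \<Lambda>' f" if f: "bounded (f ` X)" for f
    proof -
      \<comment> \<open>Along the filter clustering at \<open>\<Lambda>'\<close>,
        \<open>\<Phi>\<close> tends to \<open>\<Phi> \<Lambda>'\<close> by continuity and to 0 by
        the Cesaro bound.\<close>
      define \<Phi> where "\<Phi> = (\<lambda>\<Lambda>::('x \<Rightarrow> complex) \<Rightarrow> complex. \<Lambda> (\<lambda>x. f (T x)) - \<Lambda> f)"
      have "continuous_on UNIV \<Phi>"
        unfolding \<Phi>_def by (intro continuous_intros continuous_on_product_coordinates)
      then have "\<forall>x\<in>UNIV. (\<Phi> \<longlongrightarrow> \<Phi> x) (at x)"
        by (rule continuous_on_def [THEN iffD1])
      then have "(\<Phi> \<longlongrightarrow> \<Phi> \<Lambda>') (at \<Lambda>')"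
        by (rule bspec) (rule UNIV_I)
      then have "(\<Phi> \<longlongrightarrow> \<Phi> \<Lambda>') (nhds \<Lambda>')"
        by (rule tendsto_at_iff_tendsto_nhds [THEN iffD1])
      then have 1: "(\<Phi> \<longlongrightarrow> \<Phi> \<Lambda>') (inf (nhds \<Lambda>') (filtermap A sequentially))"
        by (rule tendsto_mono [rotated]) simp
      obtain K where K: "\<And>x. x \<in> X \<Longrightarrow> cmod (f x) \<le> K"
        using f by (auto simp: bounded_iff)
      have "(\<lambda>n. \<Phi> (A n)) \<longlonglongrightarrow> 0"
      proof (rule Lim_null_comparison)
        show "\<forall>\<^sub>F n in sequentially. cmod (\<Phi> (A n)) \<le> 2 * K / real (Suc n)"
          unfolding \<Phi>_def by (intro always_eventually allI av(2) K)
        show "(\<lambda>n. 2 * K / real (Suc n)) \<longlonglongrightarrow> 0"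
          by (rule LIMSEQ_Suc [OF lim_const_over_n])
      qed
      then have "(\<Phi> \<longlongrightarrow> 0) (filtermap A sequentially)"
        by (simp add: filterlim_filtermap)
      then have "(\<Phi> \<longlongrightarrow> 0) (inf (nhds \<Lambda>') (filtermap A sequentially))"
        by (rule tendsto_mono [rotated]) simp
      with 1 have "\<Phi> \<Lambda>' = 0"
        using tendsto_unique \<Lambda>'(2) by blast
      then show ?thesis
        by (simp add: \<Phi>_def)
    qed
    then have "\<Lambda>' \<in> M \<inter> (\<Inter>T\<in>insert T W. I T)"
      using \<Lambda>'(1) by (auto simp: I_def)
    then show ?case
      by blast
  qed
  then have "M \<inter> (\<Inter>T\<in>V. I T) \<noteq> {}"
    by (rule compact_imp_fip_image [OF \<open>compact M\<close> clI])
  then obtain \<Lambda> where "\<Lambda> \<in> M" "\<forall>T\<in>V. \<Lambda> \<in> I T"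
    by auto
  then show ?thesis
    using that by (auto simp: M_def I_def)
qed

section \<open>Quasi-unitary elements of a C*-algebra\<close>

lemma scaleC_zero_left [simp]: "0 *\<^sub>C (x::'a::complex_banach) = 0"
  and scaleC_zero_right [simp]: "c *\<^sub>C (0::'a) = 0"
  and scaleC_one [simp]: "1 *\<^sub>C (x::'a) = x"
  and scaleC_minus_left: "(- c) *\<^sub>C (x::'a) = - (c *\<^sub>C x)"
  and scaleC_diff_right: "c *\<^sub>C ((x::'a) - y) = c *\<^sub>C x - c *\<^sub>C y"
  by (rule complex_vec.scale_zero_left complex_vec.scale_zero_right complex_vec.scale_one
      complex_vec.scale_minus_left complex_vec.scale_right_diff_distrib)+

lemma star_zero [simp]: "star (0::'a::cstar_algebra) = 0"
  using star_scaleC [of 0 "0::'a"] by simp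

lemma star_minus: "star (- x) = - star (x::'a::cstar_algebra)"
  using star_scaleC [of "-1" x] by (simp add: scaleC_minus_left)

lemma star_diff: "star (x - y) = star x - star (y::'a::cstar_algebra)"
  using star_add [of x "- y"] by (simp add: star_minus)

lemma star_scaleR: "star (r *\<^sub>R x) = r *\<^sub>R star (x::'a::cstar_algebra)"
  using star_scaleC [of "of_real r" x] by (simp add: scaleC_of_real)

text \<open>The class does not postulate an isometric involution; the C*-identity gives
  \<open>norm x * norm x \<le> norm (star x) * norm x\<close>, and \<open>star\<close> is its own
  inverse.\<close>

lemma norm_star [simp]: "norm (star x) = norm (x::'a::cstar_algebra)"
proof -
  have le: "norm x \<le> norm (star x)" for x :: 'a
  proof (cases "norm x = 0")
    case False
    have "norm x * norm x \<le> norm (star x) * norm x"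
      using norm_mult_ineq [of "star x" x] by (simp add: norm_star_mult power2_eq_square)
    then show ?thesis
      using False mult_right_le_imp_le by fastforce
  qed simp
  show ?thesis
    using le [of x] le [of "star x"] by (simp add: star_star)
qed

lemma bounded_linear_star: "bounded_linear (star :: 'a::cstar_algebra \<Rightarrow> 'a)"
  by (rule bounded_linear_intro [of _ 1]) (simp_all add: star_add star_scaleR)

text \<open>The elements \<open>s\<close> for which \<open>1 + s\<close> is a unitary of the unitization.\<close>

definition quasi_unitary :: "'a::cstar_algebra \<Rightarrow> bool" where
  "quasi_unitary s \<longleftrightarrow> star s + s + star s * s = 0 \<and> star s + s + s * star s = 0"

lemma quasi_unitary_zero [simp]: "quasi_unitary 0"
  by (simp add: quasi_unitary_def)

lemma quasi_unitary_star: "quasi_unitary s \<Longrightarrow> quasi_unitary (star s)"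
  by (simp add: quasi_unitary_def star_star add.commute)

text \<open>\<open>x + s * x\<close> is (1 + s) x, and the C*-identity turns star (1 + s) (1 + s) =
  1 into isometry.\<close>

lemma quasi_unitary_norm:
  assumes "quasi_unitary s"
  shows "norm (x + s * x) = norm x"
proof -
  have "star (x + s * x) * (x + s * x) = star x * x + star x * (star s + s + star s * s) * x"
    by (simp add: star_add star_mult algebra_simps)
  then have "(norm (x + s * x))\<^sup>2 = (norm x)\<^sup>2"
    using assms by (simp add: quasi_unitary_def flip: norm_star_mult)
  then show ?thesis
    by simp
qed

text \<open>A unitary has distance at most 2 from 1. Here this comes from
  \<open>star s * s = - (star s + s)\<close> and the C*-identity.\<close>

lemma quasi_unitary_norm_le: "quasi_unitary s \<Longrightarrow> norm s \<le> 2"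
proof -
  assume s: "quasi_unitary s"
  have "star s * s = - (star s + s)"
    using s unfolding quasi_unitary_def by (metis eq_neg_iff_add_eq_0 add.commute)
  then have "(norm s)\<^sup>2 = norm (star s + s)"
    by (metis norm_minus_cancel norm_star_mult)
  also have "\<dots> \<le> 2 * norm s"
    using norm_triangle_ineq [of "star s" s] by simp
  finally show ?thesis
    by (cases "norm s = 0") (simp_all add: power2_eq_square)
qed

text \<open>With \<open>1 + s = sqrt (1 - h\<^sup>2)\<close>, found as a fixed point, the element \<open>1 + s - i h\<close> is unitary.\<close>

lemma selfadjoint_quasi_unitary:
  fixes h :: "'a::cstar_algebra"
  assumes h: "star h = h" "norm h < 1"
  obtains u where "quasi_unitary u" "star u - u = (2 * \<i>) *\<^sub>C h"
proof -
  \<comment> \<open>Selfadjointness and commutation with h are wanted of the fixed point, so they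
    are built into the complete set on which the contraction acts.\<close>
  define X where "X = cball 0 (norm h) \<inter> {s. star s = s} \<inter> {s. s * h = h * s}"
  \<comment> \<open>(1 + s)^2 = 1 - h^2 says s = - (h^2 + s^2) / 2.\<close>
  define \<Phi> where "\<Phi> s = - ((1/2) *\<^sub>R (h * h + s * s))" for s
  have cs: "continuous_on UNIV (star :: 'a \<Rightarrow> 'a)"
    using bounded_linear_star by (rule linear_continuous_on)
  have "closed X"
    unfolding X_def by (intro closed_Int closed_cball closed_Collect_eq cs continuous_intros)
  then have "complete X"
    by (simp add: complete_eq_closed)
  moreover have "X \<noteq> {}"
    proof -
    have "0 \<in> X"
      by (simp add: X_def)
    then show ?thesis
      by blast
  qed
  moreover have "\<Phi> ` X \<subseteq> X"
  proof (intro image_subsetI)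
    fix s assume s: "s \<in> X"
    have hh: "norm (h * h) \<le> norm h * norm h"
      by (rule norm_mult_ineq)
    have "norm (s * s) \<le> norm h * norm h"
      using s by (intro order.trans [OF norm_mult_ineq] mult_mono) (auto simp: X_def)
    then have "norm (h * h + s * s) \<le> norm h * norm h + norm h * norm h"
      using hh norm_triangle_ineq [of "h * h" "s * s"] by linarith
    also have "\<dots> \<le> 2 * norm h"
      using h(2) by (simp add: mult_left_le_one_le)
    finally have "norm (\<Phi> s) \<le> norm h"
      by (simp add: \<Phi>_def)
    moreover have "s * s * h = h * (s * s)"
      using s by (auto simp: X_def) (metis mult.assoc)
    moreover have "star (\<Phi> s) = \<Phi> s"
      using s h by (simp add: X_def \<Phi>_def star_minus star_scaleR star_add star_mult)
    ultimately show "\<Phi> s \<in> X"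
      by (simp add: X_def \<Phi>_def algebra_simps)
  qed
  moreover have "\<forall>s\<in>X. \<forall>t\<in>X. dist (\<Phi> s) (\<Phi> t) \<le> norm h * dist s t"
  proof (intro ballI)
    fix s t assume st: "s \<in> X" "t \<in> X"
    have "\<Phi> s - \<Phi> t = - ((1/2) *\<^sub>R (s * (s - t) + (s - t) * t))"
      by (simp add: \<Phi>_def algebra_simps)
    then have "dist (\<Phi> s) (\<Phi> t) = norm (s * (s - t) + (s - t) * t) / 2"
      by (simp add: dist_norm)
    also have "\<dots> \<le> (norm s * norm (s - t) + norm (s - t) * norm t) / 2"
      by (intro divide_right_mono order.trans [OF norm_triangle_ineq] add_mono norm_mult_ineq) simp
    also have "\<dots> \<le> (norm h * norm (s - t) + norm (s - t) * norm h) / 2"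
      using st by (intro divide_right_mono add_mono mult_mono) (auto simp: X_def)
    finally show "dist (\<Phi> s) (\<Phi> t) \<le> norm h * dist s t"
      by (simp add: dist_norm)
  qed
  ultimately have "\<exists>!s\<in>X. \<Phi> s = s"
    using h(2) by (intro Banach_fix) auto
  then obtain s where s: "s \<in> X" "\<Phi> s = s"
    by auto
  have "s + s = 2 *\<^sub>R \<Phi> s"
    using s by (simp add: scaleR_2)
  then have ss: "s + s + s * s + h * h = 0"
    by (simp add: \<Phi>_def algebra_simps)
  define u where "u = s - \<i> *\<^sub>C h"
  have su: "star u = s + \<i> *\<^sub>C h"
    using s h by (simp add: u_def X_def star_diff star_scaleC scaleC_minus_left)
  have "s * h = h * s"
    using s by (simp add: X_def)
  then have "star u * u = s * s + h * h" "u * star u = s * s + h * h"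
    unfolding su unfolding u_def
    by (simp_all add: algebra_simps scaleC_mult_left scaleC_mult_right scaleC_scaleC scaleC_minus_left
        scaleC_add_right scaleC_diff_right)
  moreover have "star u + u = s + s"
    unfolding su by (simp add: u_def)
  ultimately have "quasi_unitary u"
    using ss by (simp add: quasi_unitary_def add.assoc)
  moreover have "star u - u = (2 * \<i>) *\<^sub>C h"
    unfolding su mult_2 scaleC_add_left by (simp add: u_def)
  ultimately show ?thesis
    using that by blast
qed

text \<open>Selfadjoint elements, scaled below norm 1, are multiples of some
  \<open>star u - u\<close>; real and imaginary parts give the rest.\<close>

lemma quasi_unitary_span: "cspan (Collect quasi_unitary) = (UNIV :: 'a::cstar_algebra set)"
proof -
  let ?S = "cspan (Collect quasi_unitary) :: 'a set"
  have sa: "h \<in> ?S" if h: "star h = h" for h :: 'a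
  proof -
    define r where "r = 1 / (norm h + 1)"
    have r: "r > 0" "r * norm h < 1"
      by (simp_all add: r_def add_nonneg_pos divide_less_eq)
    then obtain u where u: "quasi_unitary u" "star u - u = (2 * \<i>) *\<^sub>C (r *\<^sub>R h)"
      using selfadjoint_quasi_unitary [of "r *\<^sub>R h"] h by (auto simp: star_scaleR)
    have "star u - u \<in> ?S"
      using u(1) quasi_unitary_star by (intro complex_vec.span_diff complex_vec.span_base) auto
    then have "(1 / (2 * \<i> * of_real r)) *\<^sub>C (star u - u) \<in> ?S"
      by (rule complex_vec.span_scale)
    also have "(1 / (2 * \<i> * of_real r)) *\<^sub>C (star u - u) = h"
      using r by (simp add: u(2) scaleC_scaleC flip: scaleC_of_real)
    finally show ?thesis .
  qed
  have "x \<in> ?S" for x :: 'a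
  proof -
    have "x = (1/2) *\<^sub>C (x + star x) + (- \<i> / 2) *\<^sub>C (\<i> *\<^sub>C (x - star x))"
      by (simp add: scaleC_scaleC scaleC_add_right scaleC_diff_right scaleC_add_left [symmetric])
    moreover have "x + star x \<in> ?S" "\<i> *\<^sub>C (x - star x) \<in> ?S"
      by (intro sa; simp add: star_add star_diff star_star star_scaleC scaleC_minus_left
          scaleC_diff_right)+
    ultimately show ?thesis
      by (metis complex_vec.span_add complex_vec.span_scale)
  qed
  then show ?thesis
    by auto
qed

section \<open>Contractivity of star-automorphisms\<close>

lemma star_automorphismD:
  assumes "star_automorphism \<phi>"
  shows star_automorphism_add: "\<phi> (x + y) = \<phi> x + \<phi> y"
    and star_automorphism_scaleC: "\<phi> (c *\<^sub>C x) = c *\<^sub>C \<phi> x"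
    and star_automorphism_mult: "\<phi> (x * y) = \<phi> x * \<phi> y"
    and star_automorphism_star: "\<phi> (star x) = star (\<phi> x)"
    and star_automorphism_bij: "bij \<phi>"
  using assms unfolding star_automorphism_def by auto

lemma star_automorphism_zero: "star_automorphism \<phi> \<Longrightarrow> \<phi> 0 = 0"
  using star_automorphism_scaleC [of \<phi> 0 0] by simp

lemma star_automorphism_diff:
  assumes "star_automorphism \<phi>" shows "\<phi> (x - y) = \<phi> x - \<phi> y"
  using star_automorphism_add [OF assms, of "x - y" y] by simp

text \<open>Instead of the spectral radius, unitaries control the norm: an automorphism preserves
  quasi-unitaries, and a selfadjoint h of norm below 1 is a multiple of \<open>star u - u\<close>.
  The C*-identity passes from selfadjoint elements to all.\<close>

lemma star_automorphism_norm_le: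
  fixes \<phi> :: "'a::cstar_algebra \<Rightarrow> 'a"
  assumes \<phi>: "star_automorphism \<phi>"
  shows "norm (\<phi> x) \<le> norm x"
proof -
  note hom = star_automorphismD(1-4) [OF \<phi>] star_automorphism_diff [OF \<phi>]
  have small: "norm (\<phi> h) \<le> 1" if h: "star h = h" "norm h < 1" for h
  proof -
    obtain u where u: "quasi_unitary u" "star u - u = (2 * \<i>) *\<^sub>C h"
      using selfadjoint_quasi_unitary [OF h] .
    have "\<phi> (star u + u + star u * u) = 0" "\<phi> (star u + u + u * star u) = 0"
      using u(1) by (simp_all add: quasi_unitary_def star_automorphism_zero [OF \<phi>])
    then have qu: "quasi_unitary (\<phi> u)"
      by (simp add: quasi_unitary_def hom)
    have "star (\<phi> u) - \<phi> u = (2 * \<i>) *\<^sub>C \<phi> h"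
      by (metis u(2) hom(2,4,5))
    \<comment> \<open>Estimating \<open>star (\<phi> u) - \<phi> u\<close> by
      \<open>quasi_unitary_norm_le\<close> would only give \<open>norm (\<phi> h) \<le> 2\<close>.
      After multiplication by \<open>\<phi> h\<close> each bracket is a unitary times
      \<open>\<phi> h\<close> and has its norm, which yields the sharp bound 1.\<close>
    then have "(2 * \<i>) *\<^sub>C (\<phi> h * \<phi> h) = (\<phi> h + star (\<phi> u) * \<phi> h) - (\<phi> h + \<phi> u * \<phi> h)"
      by (metis add_diff_cancel_left left_diff_distrib scaleC_mult_left)
    then have "2 * norm (\<phi> h * \<phi> h) \<le> norm (\<phi> h + star (\<phi> u) * \<phi> h) + norm (\<phi> h + \<phi> u * \<phi> h)"
      using norm_scaleC [of "2 * \<i>" "\<phi> h * \<phi> h"] norm_triangle_ineq4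
      by (metis mult.right_neutral norm_ii norm_mult norm_numeral)
    then have "norm (\<phi> h * \<phi> h) \<le> norm (\<phi> h)"
      using quasi_unitary_norm qu quasi_unitary_star by (metis mult_2 mult_le_cancel_left_pos zero_less_numeral)
    then have "norm (\<phi> h) * norm (\<phi> h) \<le> norm (\<phi> h)"
      using norm_star_mult [of "\<phi> h"] h hom(4) [of h] by (simp add: power2_eq_square)
    then show ?thesis
      by (cases "norm (\<phi> h) = 0") simp_all
  qed
  have sa: "norm (\<phi> h) \<le> norm h" if h: "star h = h" for h
  proof (rule field_le_epsilon)
    fix e :: real assume e: "0 < e"
    \<comment> \<open>The summand e provides the strict inequality that \<open>small\<close> asks
      for.\<close>
    define r where "r = norm h + e"
    have r: "r > 0" "norm h < r"
      using e by (simp_all add: r_def add_nonneg_pos)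
    then have "norm (\<phi> ((1 / r) *\<^sub>R h)) \<le> 1"
      using h by (intro small) (simp_all add: star_scaleR)
    moreover have "\<phi> ((1 / r) *\<^sub>R h) = (1 / r) *\<^sub>R \<phi> h"
      by (metis hom(2) scaleC_of_real)
    ultimately show "norm (\<phi> h) \<le> norm h + e"
      using r by (simp add: r_def)
  qed
  have "(norm (\<phi> x))\<^sup>2 = norm (\<phi> (star x * x))"
    by (simp add: hom norm_star_mult)
  also have "\<dots> \<le> norm (star x * x)"
    by (rule sa) (simp add: star_mult star_star)
  finally show ?thesis
    by (simp add: norm_star_mult)
qed

lemma scaleC_scaleR: "c *\<^sub>C r *\<^sub>R (x::'a::complex_banach) = r *\<^sub>R c *\<^sub>C x"
  by (metis scaleC_of_real scaleC_scaleC mult.commute)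

lemma bounded_linear_scaleC: "bounded_linear (\<lambda>x::'a::complex_banach. c *\<^sub>C x)"
  by (rule bounded_linear_intro [of _ "cmod c"])
    (simp_all add: scaleC_add_right norm_scaleC scaleC_scaleR mult.commute)

section \<open>The algebra \<open>\<ell>\<^sup>1(G,A;\<alpha>)\<close>\<close>

definition ell1 :: "('g \<Rightarrow> 'v::real_normed_vector) set" where
  "ell1 = {a. (\<lambda>g. norm (a g)) summable_on UNIV}"

definition ell1_norm :: "('g \<Rightarrow> 'v::real_normed_vector) \<Rightarrow> real" where
  "ell1_norm a = (\<Sum>\<^sub>\<infinity>g. norm (a g))"

definition ell1_single :: "'g \<Rightarrow> 'v \<Rightarrow> 'g \<Rightarrow> 'v::real_normed_vector" where
  "ell1_single g x = (\<lambda>h. if h = g then x else 0)"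

lemma ell1_norm_nonneg: "0 \<le> ell1_norm a"
  by (simp add: ell1_norm_def infsum_nonneg)

lemma norm_le_ell1_norm: "a \<in> ell1 \<Longrightarrow> norm (a g) \<le> ell1_norm a"
  using finite_sum_le_infsum [of "\<lambda>g. norm (a g)" UNIV "{g}"]
  by (simp add: ell1_def ell1_norm_def)

lemma sum_le_ell1_norm: "a \<in> ell1 \<Longrightarrow> finite S \<Longrightarrow> (\<Sum>g\<in>S. norm (a g)) \<le> ell1_norm a"
  using finite_sum_le_infsum [of "\<lambda>g. norm (a g)" UNIV S]
  by (simp add: ell1_def ell1_norm_def)

lemma ell1I_finite_sums:
  assumes "\<And>S. finite S \<Longrightarrow> (\<Sum>g\<in>S. norm (a g)) \<le> K"
  shows "a \<in> ell1" "ell1_norm a \<le> K"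
proof -
  show "a \<in> ell1"
    unfolding ell1_def using assms
    by (auto intro!: nonneg_bdd_above_summable_on bdd_aboveI)
  then show "ell1_norm a \<le> K"
    using assms by (simp add: ell1_def ell1_norm_def infsum_le_finite_sums)
qed

lemma ell1_zero: "(\<lambda>g. 0) \<in> ell1"
  by (simp add: ell1_def)

lemma ell1_norm_eq_zero_iff:
  assumes "a \<in> ell1" shows "ell1_norm a = 0 \<longleftrightarrow> a = (\<lambda>g. 0)"
  using norm_le_ell1_norm [OF assms] by (auto simp: ell1_norm_def fun_eq_iff)

lemma ell1_add:
  assumes "a \<in> ell1" "b \<in> ell1"
  shows "(\<lambda>g. a g + b g) \<in> ell1" "ell1_norm (\<lambda>g. a g + b g) \<le> ell1_norm a + ell1_norm b"
proof -
  have "(\<Sum>g\<in>S. norm (a g + b g)) \<le> ell1_norm a + ell1_norm b" if "finite S" for S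
  proof -
    have "(\<Sum>g\<in>S. norm (a g + b g)) \<le> (\<Sum>g\<in>S. norm (a g)) + (\<Sum>g\<in>S. norm (b g))"
      by (simp add: norm_triangle_ineq sum_mono flip: sum.distrib)
    also have "\<dots> \<le> ell1_norm a + ell1_norm b"
      by (intro add_mono sum_le_ell1_norm assms that)
    finally show ?thesis .
  qed
  from ell1I_finite_sums [OF this]
  show "(\<lambda>g. a g + b g) \<in> ell1" "ell1_norm (\<lambda>g. a g + b g) \<le> ell1_norm a + ell1_norm b"
    by auto
qed

lemma ell1_scaleC:
  fixes a :: "'g \<Rightarrow> 'v::complex_banach"
  assumes "a \<in> ell1"
  shows "(\<lambda>g. c *\<^sub>C a g) \<in> ell1" "ell1_norm (\<lambda>g. c *\<^sub>C a g) = cmod c * ell1_norm a"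
  using assms by (simp_all add: ell1_def ell1_norm_def norm_scaleC summable_on_cmult_right
      infsum_cmult_right)

lemma ell1_minus:
  assumes "a \<in> ell1" shows "(\<lambda>g. - a g) \<in> ell1" "ell1_norm (\<lambda>g. - a g) = ell1_norm a"
  using assms by (simp_all add: ell1_def ell1_norm_def)

lemma ell1_diff:
  assumes "a \<in> ell1" "b \<in> ell1" shows "(\<lambda>g. a g - b g) \<in> ell1"
  using ell1_add(1) [OF assms(1) ell1_minus(1) [OF assms(2)]] by simp

lemma ell1_single_has_sum: "((\<lambda>h. norm (ell1_single g x h)) has_sum norm x) UNIV"
  by (rule has_sum_finite_neutralI [of "{g}"]) (auto simp: ell1_single_def)

lemma ell1_single: "ell1_single g x \<in> ell1" "ell1_norm (ell1_single g x) = norm x"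
  using ell1_single_has_sum [of g x]
  by (auto simp: ell1_def ell1_norm_def infsumI has_sum_imp_summable)

lemma ell1_zero_outside_finite:
  fixes F :: "('g \<Rightarrow> 'v::real_normed_vector) \<Rightarrow> 'w::real_normed_vector"
  assumes add: "\<And>a b. a \<in> ell1 \<Longrightarrow> b \<in> ell1 \<Longrightarrow> F (\<lambda>g. a g + b g) = F a + F b"
    and single: "\<And>g x. F (ell1_single g x) = 0"
    and "finite S"
  shows "(\<lambda>g. if g \<in> S then a g else 0) \<in> ell1 \<and> F (\<lambda>g. if g \<in> S then a g else 0) = 0"
  using \<open>finite S\<close>
proof (induction S)
  case empty
  have "ell1_single undefined 0 = (\<lambda>g::'g. 0::'v)"
    by (auto simp: ell1_single_def)
  then have "F (\<lambda>g. 0) = 0"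
    using single by metis
  then show ?case
    using ell1_zero by simp
next
  case (insert h S)
  have "(\<lambda>g. if g \<in> insert h S then a g else 0) =
      (\<lambda>g. ell1_single h (a h) g + (if g \<in> S then a g else 0))"
    using insert.hyps by (auto simp: ell1_single_def)
  then show ?case
    using insert.IH add [OF ell1_single(1), of "\<lambda>g. if g \<in> S then a g else 0" h "a h"]
      ell1_add(1) [OF ell1_single(1), of "\<lambda>g. if g \<in> S then a g else 0" h "a h"]
    by (simp add: single)
qed

text \<open>Density of the finitely supported functions. Additivity suffices to reach them because
  the point masses carry arbitrary coefficients x.\<close>

lemma ell1_eq_zeroI:
  fixes F :: "('g \<Rightarrow> 'v::real_normed_vector) \<Rightarrow> 'w::real_normed_vector"
  assumes add: "\<And>a b. a \<in> ell1 \<Longrightarrow> b \<in> ell1 \<Longrightarrow> F (\<lambda>g. a g + b g) = F a + F b"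
    and bound: "\<And>a. a \<in> ell1 \<Longrightarrow> norm (F a) \<le> K * ell1_norm a"
    and single: "\<And>g x. F (ell1_single g x) = 0"
    and a: "a \<in> ell1"
  shows "F a = 0"
proof -
  have "norm (F a) \<le> 0 + e" if "e > 0" for e
  proof -
    \<comment> \<open>\<open>\<bar>K\<bar> + 1\<close> is positive for every K; the tail b of a will
      have norm at most d.\<close>
    define d where "d = e / (\<bar>K\<bar> + 1)"
    have d: "d > 0"
      using that by (simp add: d_def)
    have "(\<lambda>g. norm (a g)) summable_on UNIV"
      using a by (simp add: ell1_def)
    from infsum_finite_approximation [OF this d] obtain S where S: "finite S"
      "dist (\<Sum>g\<in>S. norm (a g)) (ell1_norm a) \<le> d"
      by (auto simp: ell1_norm_def)
    define b where "b = (\<lambda>g. if g \<in> S then 0 else a g)"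
    have "(\<Sum>g\<in>R. norm (b g)) \<le> d" if R: "finite R" for R
    proof -
      have "(\<Sum>g\<in>R. norm (b g)) = (\<Sum>g\<in>R - S. norm (a g))"
        using R by (intro sum.mono_neutral_cong_right) (auto simp: b_def)
      moreover have "(\<Sum>g\<in>R - S. norm (a g)) + (\<Sum>g\<in>S. norm (a g)) = (\<Sum>g\<in>R \<union> S. norm (a g))"
        using R S(1) by (subst sum.union_disjoint [symmetric]) (auto intro: sum.cong)
      moreover have "\<dots> \<le> ell1_norm a"
        using R S(1) a by (intro sum_le_ell1_norm) auto
      ultimately show ?thesis
        using S(2) by (simp add: dist_real_def)
    qed
    then have b: "b \<in> ell1" "ell1_norm b \<le> d"
      using ell1I_finite_sums by blast+
    have zero: "(\<lambda>g. if g \<in> S then a g else 0) \<in> ell1 \<and> F (\<lambda>g. if g \<in> S then a g else 0) = 0"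
      using add single S(1) by (rule ell1_zero_outside_finite)
    have "F a = F (\<lambda>g. (if g \<in> S then a g else 0) + b g)"
      by (rule arg_cong [of _ _ F]) (auto simp: b_def)
    also have "\<dots> = F b"
      using add [of "\<lambda>g. if g \<in> S then a g else 0" b] b(1) zero by simp
    finally have "norm (F a) \<le> K * ell1_norm b"
      using bound b(1) by simp
    also have "\<dots> \<le> (\<bar>K\<bar> + 1) * d"
      using b(2) ell1_norm_nonneg [of b] by (intro mult_mono) auto
    finally show ?thesis
      by (simp add: d_def)
  qed
  then have "norm (F a) \<le> 0"
    by (rule field_le_epsilon)
  then show ?thesis
    by simp
qed

text \<open>The tool that reduces associativity of the convolution and the laws of the crossed
  diagonal to point masses.\<close>

lemma ell1_eqI:
  fixes F F' :: "('g \<Rightarrow> 'v::real_normed_vector) \<Rightarrow> 'w::real_normed_vector"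
  assumes "\<And>a b. a \<in> ell1 \<Longrightarrow> b \<in> ell1 \<Longrightarrow> F (\<lambda>g. a g + b g) = F a + F b"
    and "\<And>a b. a \<in> ell1 \<Longrightarrow> b \<in> ell1 \<Longrightarrow> F' (\<lambda>g. a g + b g) = F' a + F' b"
    and F: "\<And>a. a \<in> ell1 \<Longrightarrow> norm (F a) \<le> K * ell1_norm a"
    and F': "\<And>a. a \<in> ell1 \<Longrightarrow> norm (F' a) \<le> K' * ell1_norm a"
    and "\<And>g x. F (ell1_single g x) = F' (ell1_single g x)"
    and a: "a \<in> ell1"
  shows "F a = F' a"
proof -
  have "F a - F' a = 0"
  proof (rule ell1_eq_zeroI [where F = "\<lambda>a. F a - F' a" and K = "K + K'"])
    fix a b :: "'g \<Rightarrow> 'v" assume ab: "a \<in> ell1" "b \<in> ell1"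
    show "F (\<lambda>g. a g + b g) - F' (\<lambda>g. a g + b g) = F a - F' a + (F b - F' b)"
      unfolding assms(1) [OF ab] assms(2) [OF ab] by simp
    show "norm (F a - F' a) \<le> (K + K') * ell1_norm a"
      using norm_triangle_ineq4 [of "F a" "F' a"] F [OF ab(1)] F' [OF ab(1)]
      by (simp add: distrib_right)
  qed (use a assms(5) in simp_all)
  then show ?thesis
    by simp
qed

text \<open>The pointwise limit is the norm limit: the Cauchy estimate survives the limit in every
  finite sum, and finite sums determine the norm.\<close>

lemma ell1_complete:
  fixes s :: "nat \<Rightarrow> 'g \<Rightarrow> 'v::banach"
  assumes s: "\<And>n. s n \<in> ell1"
    and cauchy: "\<And>e. 0 < e \<Longrightarrow> \<exists>N. \<forall>m\<ge>N. \<forall>n\<ge>N. ell1_norm (\<lambda>g. s m g - s n g) < e"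
  shows "\<exists>a\<in>ell1. (\<lambda>n. ell1_norm (\<lambda>g. s n g - a g)) \<longlonglongrightarrow> 0"
proof -
  have diff_le: "norm (s m g - s n g) \<le> ell1_norm (\<lambda>g. s m g - s n g)" for m n g
    using norm_le_ell1_norm [OF ell1_diff [OF s [of m] s [of n]], of g] by simp
  have "Cauchy (\<lambda>n. s n g)" for g
  proof (rule metric_CauchyI)
    fix e :: real assume "0 < e"
    then obtain N where "\<forall>m\<ge>N. \<forall>n\<ge>N. ell1_norm (\<lambda>g. s m g - s n g) < e"
      using cauchy by blast
    then show "\<exists>N. \<forall>m\<ge>N. \<forall>n\<ge>N. dist (s m g) (s n g) < e"
      unfolding dist_norm using diff_le le_less_trans by blast
  qed
  then have "\<exists>l. (\<lambda>n. s n g) \<longlonglongrightarrow> l" for g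
    by (simp add: Cauchy_convergent convergent_def [symmetric])
  then obtain a where a: "\<And>g. (\<lambda>n. s n g) \<longlonglongrightarrow> a g"
    by metis
  have tail: "\<exists>N. \<forall>n\<ge>N. (\<lambda>g. s n g - a g) \<in> ell1 \<and> ell1_norm (\<lambda>g. s n g - a g) \<le> e" if "0 < e" for e
  proof -
    obtain N where N: "\<forall>m\<ge>N. \<forall>n\<ge>N. ell1_norm (\<lambda>g. s m g - s n g) < e"
      using cauchy [OF \<open>0 < e\<close>] by blast
    have "(\<Sum>g\<in>S. norm (s n g - a g)) \<le> e" if "finite S" "n \<ge> N" for S n
    proof (rule tendsto_upperbound)
      show "(\<lambda>m. \<Sum>g\<in>S. norm (s n g - s m g)) \<longlonglongrightarrow> (\<Sum>g\<in>S. norm (s n g - a g))"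
        by (intro tendsto_intros a)
      show "\<forall>\<^sub>F m in sequentially. (\<Sum>g\<in>S. norm (s n g - s m g)) \<le> e"
        using eventually_ge_at_top [of N]
      proof eventually_elim
        case (elim m)
        then show ?case
          using N that sum_le_ell1_norm [OF ell1_diff [OF s s] \<open>finite S\<close>] less_imp_le order_trans
          by (metis (no_types, lifting))
      qed
    qed simp
    then have "(\<lambda>g. s n g - a g) \<in> ell1 \<and> ell1_norm (\<lambda>g. s n g - a g) \<le> e" if "n \<ge> N" for n
      using ell1I_finite_sums [of "\<lambda>g. s n g - a g" e] that by simp
    then show ?thesis
      by blast
  qed
  obtain n where "(\<lambda>g. s n g - a g) \<in> ell1"
    using tail [OF zero_less_one] by blast
  then have "(\<lambda>g. s n g - (s n g - a g)) \<in> ell1"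
    by (rule ell1_diff [OF s])
  then have "a \<in> ell1"
    by simp
  moreover have "(\<lambda>n. ell1_norm (\<lambda>g. s n g - a g)) \<longlonglongrightarrow> 0"
  proof (rule LIMSEQ_I)
    fix e :: real assume "0 < e"
    then obtain N where N: "\<forall>n\<ge>N. ell1_norm (\<lambda>g. s n g - a g) \<le> e / 2"
      using tail [of "e / 2"] by auto
    have "norm (ell1_norm (\<lambda>g. s n g - a g) - 0) < e" if "n \<ge> N" for n
      using N [rule_format, OF that] \<open>0 < e\<close> ell1_norm_nonneg [of "\<lambda>g. s n g - a g"] by simp
    then show "\<exists>N. \<forall>n\<ge>N. norm (ell1_norm (\<lambda>g. s n g - a g) - 0) < e"
      by blast
  qed
  ultimately show ?thesis
    by blast
qed

section \<open>The twisted convolution\<close>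

locale cstar_system =
  fixes \<alpha> :: "'g::group_add \<Rightarrow> 'a::cstar_algebra \<Rightarrow> 'a"
  assumes action: "cstar_action \<alpha>"
begin

lemma act_automorphism: "star_automorphism (\<alpha> g)"
  using action by (simp add: cstar_action_def)

lemmas act_add = star_automorphism_add [OF act_automorphism]
  and act_scaleC = star_automorphism_scaleC [OF act_automorphism]
  and act_mult = star_automorphism_mult [OF act_automorphism]
  and act_zero [simp] = star_automorphism_zero [OF act_automorphism]
  and act_norm_le = star_automorphism_norm_le [OF act_automorphism]

lemma act_plus: "\<alpha> (g + h) x = \<alpha> g (\<alpha> h x)"
  using action by (simp add: cstar_action_def)

text \<open>The action axioms contain no unit law; injectivity of \<open>\<alpha> 0\<close> turns
  \<open>\<alpha> 0 (\<alpha> 0 x) = \<alpha> 0 x\<close> into one.\<close>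

lemma act_0 [simp]: "\<alpha> 0 x = x"
  using act_plus [of 0 0 x] star_automorphism_bij [OF act_automorphism, of 0] by (simp add: bij_def inj_eq)

lemma act_minus_cancel [simp]: "\<alpha> g (\<alpha> (- g) x) = x" "\<alpha> (- g) (\<alpha> g x) = x"
  by (simp_all flip: act_plus)

definition conv :: "('g \<Rightarrow> 'a) \<Rightarrow> ('g \<Rightarrow> 'a) \<Rightarrow> 'g \<Rightarrow> 'a" where
  "conv a b = (\<lambda>g. \<Sum>\<^sub>\<infinity>k. a k * \<alpha> k (b (- k + g)))"

text \<open>Fubini for the majorant \<open>norm (a k) * norm (b (- k + g))\<close>: contractivity of
  the action bounds the terms by it, and translating the sum over g evaluates its total to the
  product of the norms.\<close>

lemma conv_summable:
  assumes a: "a \<in> ell1" and b: "b \<in> ell1"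
  shows "(\<lambda>k. norm (a k * \<alpha> k (b (- k + g)))) summable_on UNIV"
    and "conv a b \<in> ell1" and "ell1_norm (conv a b) \<le> ell1_norm a * ell1_norm b"
proof -
  define P where "P k g = norm (a k) * norm (b (- k + g))" for k g
  have bsum: "((\<lambda>g. norm (b (- k + g))) has_sum ell1_norm b) UNIV" for k
  proof -
    have "bij_betw (\<lambda>g. - k + g) UNIV UNIV"
      by (rule bij_betw_byWitness [where f' = "\<lambda>g. k + g"]) (auto simp: add.assoc [symmetric])
    then show ?thesis
      using b by (subst has_sum_reindex_bij_betw) (auto simp: ell1_def ell1_norm_def)
  qed
  have Pk: "(P k has_sum norm (a k) * ell1_norm b) UNIV" for k
    unfolding P_def by (intro has_sum_cmult_right bsum)
  have P: "(\<lambda>(k, g). P k g) summable_on UNIV \<times> UNIV"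
  proof (rule summable_on_SigmaI [where g = "\<lambda>k. norm (a k) * ell1_norm b"])
    show "((\<lambda>g. case (k, g) of (k, g) \<Rightarrow> P k g) has_sum norm (a k) * ell1_norm b) UNIV" for k
      using Pk by simp
    show "(\<lambda>k. norm (a k) * ell1_norm b) summable_on UNIV"
      using a by (intro summable_on_cmult_left) (simp add: ell1_def)
  qed (simp add: P_def)
  have "(\<Sum>\<^sub>\<infinity>g. \<Sum>\<^sub>\<infinity>k. P k g) = (\<Sum>\<^sub>\<infinity>k. \<Sum>\<^sub>\<infinity>g. P k g)"
    using infsum_swap_banach [OF P] by simp
  also have "\<dots> = ell1_norm a * ell1_norm b"
    using a by (simp add: infsumI [OF Pk] infsum_cmult_left ell1_def ell1_norm_def)
  finally have total: "(\<Sum>\<^sub>\<infinity>g. \<Sum>\<^sub>\<infinity>k. P k g) = ell1_norm a * ell1_norm b" .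
  have P': "(\<lambda>(g, k). P k g) summable_on UNIV \<times> UNIV"
    using P by (subst summable_on_swap) simp
  have Pg: "(\<lambda>k. P k g) summable_on UNIV" for g
    using summable_on_SigmaD1 [OF P'] by simp
  have le: "norm (a k * \<alpha> k (b (- k + g))) \<le> P k g" for k g
    unfolding P_def by (intro order.trans [OF norm_mult_ineq] mult_left_mono act_norm_le) simp
  show sum: "(\<lambda>k. norm (a k * \<alpha> k (b (- k + g)))) summable_on UNIV" for g
    using Pg le by (rule summable_on_comparison_test) simp
  have conv_le: "norm (conv a b g) \<le> (\<Sum>\<^sub>\<infinity>k. P k g)" for g
    unfolding conv_def by (intro order.trans [OF norm_infsum_bound [OF sum]] infsum_mono sum Pg le)
  have Psum: "(\<lambda>g. \<Sum>\<^sub>\<infinity>k. P k g) summable_on UNIV"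
    using summable_on_Sigma_banach [OF P'] by simp
  show "conv a b \<in> ell1"
    unfolding ell1_def using summable_on_comparison_test [OF Psum conv_le] by simp
  then show "ell1_norm (conv a b) \<le> ell1_norm a * ell1_norm b"
    unfolding total [symmetric] by (simp add: ell1_norm_def ell1_def infsum_mono conv_le Psum)
qed

lemma conv_terms_summable:
  assumes "a \<in> ell1" "b \<in> ell1" shows "(\<lambda>k. a k * \<alpha> k (b (- k + g))) summable_on UNIV"
  by (rule abs_summable_summable [OF conv_summable(1) [OF assms]])

lemma conv_norm_le:
  assumes "a \<in> ell1" "b \<in> ell1" shows "norm (conv a b g) \<le> ell1_norm a * ell1_norm b"
  using norm_le_ell1_norm [OF conv_summable(2) [OF assms]] conv_summable(3) [OF assms]
  by (rule order.trans)

lemma conv_add_left: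
  assumes "a \<in> ell1" "b \<in> ell1" "d \<in> ell1"
  shows "conv (\<lambda>g. a g + b g) d = (\<lambda>g. conv a d g + conv b d g)"
  using infsum_add [OF conv_terms_summable [OF assms(1,3)] conv_terms_summable [OF assms(2,3)]]
  by (simp add: conv_def distrib_right)

lemma conv_add_right:
  assumes "a \<in> ell1" "b \<in> ell1" "d \<in> ell1"
  shows "conv a (\<lambda>g. b g + d g) = (\<lambda>g. conv a b g + conv a d g)"
  using infsum_add [OF conv_terms_summable [OF assms(1,2)] conv_terms_summable [OF assms(1,3)]]
  by (simp add: conv_def distrib_left act_add)

lemma conv_single_left: "conv (ell1_single h y) b g = y * \<alpha> h (b (- h + g))"
  unfolding conv_def
  by (subst infsum_cong_neutral [where T = "{h}" and g = "\<lambda>k. y * \<alpha> h (b (- h + g))"])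
    (auto simp: ell1_single_def)

lemma conv_single_single:
  "conv (ell1_single h y) (ell1_single g x) = ell1_single (h + g) (y * \<alpha> h x)"
proof -
  have "- h + k = g \<longleftrightarrow> k = h + g" for k
    by (metis add_minus_cancel minus_add_cancel)
  then have "conv (ell1_single h y) (ell1_single g x) k = ell1_single (h + g) (y * \<alpha> h x) k" for k
    unfolding conv_single_left unfolding ell1_single_def by simp
  then show ?thesis ..
qed

lemma conv_scaleC_left:
  assumes "a \<in> ell1" "b \<in> ell1"
  shows "conv (\<lambda>g. c *\<^sub>C a g) b = (\<lambda>g. c *\<^sub>C conv a b g)"
proof
  fix g
  have "((\<lambda>k. c *\<^sub>C (a k * \<alpha> k (b (- k + g)))) has_sum c *\<^sub>C conv a b g) UNIV"
    unfolding conv_def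
    by (rule has_sum_bounded_linear
        [OF bounded_linear_scaleC has_sum_infsum [OF conv_terms_summable [OF assms]]])
  from infsumI [OF this] show "conv (\<lambda>g. c *\<^sub>C a g) b g = c *\<^sub>C conv a b g"
    by (simp add: conv_def scaleC_mult_left)
qed

lemma conv_scaleC_right:
  assumes "a \<in> ell1" "b \<in> ell1"
  shows "conv a (\<lambda>g. c *\<^sub>C b g) = (\<lambda>g. c *\<^sub>C conv a b g)"
  unfolding conv_scaleC_left [OF assms, symmetric]
  by (simp add: conv_def act_scaleC scaleC_mult_left scaleC_mult_right)

text \<open>Both sides are additive and bounded in a and in b, so these two become point masses.
  Convolution with a point mass from the left is a single term, so d can stay arbitrary and no
  triple sum is rearranged.\<close>

lemma conv_assoc:
  assumes "a \<in> ell1" "b \<in> ell1" "d \<in> ell1"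
  shows "conv (conv a b) d = conv a (conv b d)"
proof
  fix g
  note c = conv_summable(2)
  have single: "conv (conv (ell1_single h y) b) d g = conv (ell1_single h y) (conv b d) g" for h y
  proof (rule ell1_eqI [where F = "\<lambda>b. conv (conv (ell1_single h y) b) d g"
          and F' = "\<lambda>b. conv (ell1_single h y) (conv b d) g"
          and K = "norm y * ell1_norm d" and K' = "norm y * ell1_norm d"])
    fix b :: "'g \<Rightarrow> 'a" assume b: "b \<in> ell1"
    have "norm (conv (conv (ell1_single h y) b) d g) \<le> ell1_norm (conv (ell1_single h y) b) * ell1_norm d"
      by (intro conv_norm_le c ell1_single b assms)
    also have "\<dots> \<le> (norm y * ell1_norm b) * ell1_norm d"
      using conv_summable(3) [OF ell1_single(1) b]
      by (intro mult_right_mono ell1_norm_nonneg) (simp add: ell1_single)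
    finally show "norm (conv (conv (ell1_single h y) b) d g) \<le> norm y * ell1_norm d * ell1_norm b"
      by (simp add: algebra_simps)
    have "norm (conv (ell1_single h y) (conv b d) g) \<le> norm y * ell1_norm (conv b d)"
      by (metis conv_norm_le c ell1_single b assms(3))
    also have "\<dots> \<le> norm y * (ell1_norm b * ell1_norm d)"
      by (intro mult_left_mono conv_summable b assms) simp
    finally show "norm (conv (ell1_single h y) (conv b d) g) \<le> norm y * ell1_norm d * ell1_norm b"
      by (simp add: algebra_simps)
  next
    fix j z
    show "conv (conv (ell1_single h y) (ell1_single j z)) d g =
        conv (ell1_single h y) (conv (ell1_single j z) d) g"
      unfolding conv_single_single conv_single_left act_mult mult.assoc
      by (simp add: act_plus minus_add add.assoc del: add_uminus_conv_diff)
  qed (simp_all add: conv_add_left conv_add_right c ell1_single ell1_add assms)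
  show "conv (conv a b) d g = conv a (conv b d) g"
  proof (rule ell1_eqI [where F = "\<lambda>a. conv (conv a b) d g" and F' = "\<lambda>a. conv a (conv b d) g"
          and K = "ell1_norm b * ell1_norm d" and K' = "ell1_norm b * ell1_norm d"])
    fix a :: "'g \<Rightarrow> 'a" assume a: "a \<in> ell1"
    have "norm (conv (conv a b) d g) \<le> ell1_norm (conv a b) * ell1_norm d"
      by (intro conv_norm_le c a assms)
    also have "\<dots> \<le> (ell1_norm a * ell1_norm b) * ell1_norm d"
      by (intro mult_right_mono ell1_norm_nonneg conv_summable a assms)
    finally show "norm (conv (conv a b) d g) \<le> ell1_norm b * ell1_norm d * ell1_norm a"
      by (simp add: algebra_simps)
    have "norm (conv a (conv b d) g) \<le> ell1_norm a * ell1_norm (conv b d)"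
      by (intro conv_norm_le c a assms)
    also have "\<dots> \<le> ell1_norm a * (ell1_norm b * ell1_norm d)"
      by (intro mult_left_mono ell1_norm_nonneg conv_summable assms)
    finally show "norm (conv a (conv b d) g) \<le> ell1_norm b * ell1_norm d * ell1_norm a"
      by (simp add: algebra_simps)
  qed (simp_all add: conv_add_left c ell1_add assms single)
qed

lemma l1_algebra_simps [simp]:
  "na_carrier (l1_algebra \<alpha>) = ell1"
  "na_zero (l1_algebra \<alpha>) = (\<lambda>g. 0)"
  "na_add (l1_algebra \<alpha>) = (\<lambda>a b g. a g + b g)"
  "na_scale (l1_algebra \<alpha>) = (\<lambda>c a g. c *\<^sub>C a g)"
  "na_mult (l1_algebra \<alpha>) = conv"
  "na_norm (l1_algebra \<alpha>) = ell1_norm"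
  "na_diff (l1_algebra \<alpha>) = (\<lambda>a b g. a g - b g)"
  by (simp_all add: l1_algebra_def ell1_def ell1_norm_def conv_def fun_eq_iff na_diff_def
      scaleC_minus_left)

lemma banach_algebra_l1: "banach_algebra (l1_algebra \<alpha>)"
proof
  fix s :: "nat \<Rightarrow> 'g \<Rightarrow> 'a"
  assume "\<And>n. s n \<in> na_carrier (l1_algebra \<alpha>)"
    and "\<And>e. 0 < e \<Longrightarrow> \<exists>N. \<forall>m\<ge>N. \<forall>n\<ge>N. na_norm (l1_algebra \<alpha>) (na_diff (l1_algebra \<alpha>) (s m) (s n)) < e"
  then show "\<exists>a\<in>na_carrier (l1_algebra \<alpha>). (\<lambda>n. na_norm (l1_algebra \<alpha>) (na_diff (l1_algebra \<alpha>) (s n) a)) \<longlonglongrightarrow> 0"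
    unfolding l1_algebra_simps by (rule ell1_complete)
qed (simp_all add: ell1_zero ell1_add ell1_scaleC ell1_norm_nonneg ell1_norm_eq_zero_iff
    conv_summable conv_add_left conv_add_right conv_scaleC_left conv_scaleC_right conv_assoc
    scaleC_add_right scaleC_add_left scaleC_scaleC add_ac)

end

section \<open>Virtual diagonals\<close>

text \<open>The bound is an argument so that estimates can be uniform. In the zero algebra the norm
  estimate alone would admit negative K.\<close>

definition bounded_functional :: "'b normed_alg \<Rightarrow> ('b \<Rightarrow> complex) \<Rightarrow> real \<Rightarrow> bool" where
  "bounded_functional B f K \<longleftrightarrow> 0 \<le> K \<and>
     (\<forall>a\<in>na_carrier B. \<forall>b\<in>na_carrier B. f (na_add B a b) = f a + f b) \<and>
     (\<forall>c. \<forall>a\<in>na_carrier B. f (na_scale B c a) = c * f a) \<and>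
     (\<forall>a\<in>na_carrier B. cmod (f a) \<le> K * na_norm B a)"

definition bounded_form :: "'b normed_alg \<Rightarrow> ('b \<Rightarrow> 'b \<Rightarrow> complex) \<Rightarrow> real \<Rightarrow> bool" where
  "bounded_form B T K \<longleftrightarrow> 0 \<le> K \<and>
     (\<forall>a\<in>na_carrier B. \<forall>b\<in>na_carrier B. \<forall>d\<in>na_carrier B.
        T (na_add B a b) d = T a d + T b d \<and> T d (na_add B a b) = T d a + T d b) \<and>
     (\<forall>c. \<forall>a\<in>na_carrier B. \<forall>b\<in>na_carrier B.
        T (na_scale B c a) b = c * T a b \<and> T a (na_scale B c b) = c * T a b) \<and>
     (\<forall>a\<in>na_carrier B. \<forall>b\<in>na_carrier B. cmod (T a b) \<le> K * na_norm B a * na_norm B b)"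

text \<open>A virtual diagonal is an element of the bidual of the projective tensor square of \<open>B\<close>,
  that is, a functional on the space of bounded bilinear forms on \<open>B\<close>.\<close>

definition virtual_diagonal ::
  "'b normed_alg \<Rightarrow> (('b \<Rightarrow> 'b \<Rightarrow> complex) \<Rightarrow> complex) \<Rightarrow> bool" where
  "virtual_diagonal B M \<longleftrightarrow>
     (\<exists>C. 0 \<le> C \<and> (\<forall>T K. bounded_form B T K \<longrightarrow> cmod (M T) \<le> C * K)) \<and>
     (\<forall>T T' K K'. bounded_form B T K \<longrightarrow> bounded_form B T' K' \<longrightarrow>
        M (\<lambda>a b. T a b + T' a b) = M T + M T') \<and>
     (\<forall>c T K. bounded_form B T K \<longrightarrow> M (\<lambda>a b. c * T a b) = c * M T) \<and>
     (\<forall>T K. \<forall>c\<in>na_carrier B. bounded_form B T K \<longrightarrow>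
        M (\<lambda>a b. T (na_mult B c a) b) = M (\<lambda>a b. T a (na_mult B b c))) \<and>
     (\<forall>f K. \<forall>c\<in>na_carrier B. bounded_functional B f K \<longrightarrow>
        M (\<lambda>a b. f (na_mult B (na_mult B a b) c)) = f c \<and>
        M (\<lambda>a b. f (na_mult B c (na_mult B a b))) = f c)"

lemma virtual_diagonalD:
  assumes "virtual_diagonal B M"
  shows virtual_diagonal_bound:
      "\<exists>C. 0 \<le> C \<and> (\<forall>T K. bounded_form B T K \<longrightarrow> cmod (M T) \<le> C * K)"
    and virtual_diagonal_add: "bounded_form B T K \<Longrightarrow> bounded_form B T' K' \<Longrightarrow>
      M (\<lambda>a b. T a b + T' a b) = M T + M T'"
    and virtual_diagonal_scale: "bounded_form B T K \<Longrightarrow> M (\<lambda>a b. c * T a b) = c * M T"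
    and virtual_diagonal_swap: "bounded_form B T K \<Longrightarrow> d \<in> na_carrier B \<Longrightarrow>
      M (\<lambda>a b. T (na_mult B d a) b) = M (\<lambda>a b. T a (na_mult B b d))"
    and virtual_diagonal_left_unit: "bounded_functional B f K \<Longrightarrow> d \<in> na_carrier B \<Longrightarrow>
      M (\<lambda>a b. f (na_mult B (na_mult B a b) d)) = f d"
    and virtual_diagonal_right_unit: "bounded_functional B f K \<Longrightarrow> d \<in> na_carrier B \<Longrightarrow>
      M (\<lambda>a b. f (na_mult B d (na_mult B a b))) = f d"
  using assms unfolding virtual_diagonal_def by blast+

lemma bounded_formD:
  assumes "bounded_form B T K"
  shows "0 \<le> K"
    and "a \<in> na_carrier B \<Longrightarrow> b \<in> na_carrier B \<Longrightarrow> d \<in> na_carrier B \<Longrightarrow>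
      T (na_add B a b) d = T a d + T b d"
    and "a \<in> na_carrier B \<Longrightarrow> b \<in> na_carrier B \<Longrightarrow> d \<in> na_carrier B \<Longrightarrow>
      T d (na_add B a b) = T d a + T d b"
    and "a \<in> na_carrier B \<Longrightarrow> b \<in> na_carrier B \<Longrightarrow> T (na_scale B c a) b = c * T a b"
    and "a \<in> na_carrier B \<Longrightarrow> b \<in> na_carrier B \<Longrightarrow> T a (na_scale B c b) = c * T a b"
    and "a \<in> na_carrier B \<Longrightarrow> b \<in> na_carrier B \<Longrightarrow>
      cmod (T a b) \<le> K * na_norm B a * na_norm B b"
  using assms unfolding bounded_form_def by blast+

lemma bounded_functionalD:
  assumes "bounded_functional B f K"
  shows "0 \<le> K"
    and "a \<in> na_carrier B \<Longrightarrow> b \<in> na_carrier B \<Longrightarrow> f (na_add B a b) = f a + f b"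
    and "a \<in> na_carrier B \<Longrightarrow> f (na_scale B c a) = c * f a"
    and "a \<in> na_carrier B \<Longrightarrow> cmod (f a) \<le> K * na_norm B a"
  using assms unfolding bounded_functional_def by blast+

lemma bounded_form_scale:
  assumes "bounded_form B T K" shows "bounded_form B (\<lambda>a b. c * T a b) (cmod c * K)"
proof -
  have "cmod (c * T a b) \<le> cmod c * K * na_norm B a * na_norm B b"
    if "a \<in> na_carrier B" "b \<in> na_carrier B" for a b
    using mult_left_mono [OF bounded_formD(6) [OF assms that], of "cmod c"]
    by (simp add: norm_mult mult.assoc)
  then show ?thesis
    using bounded_formD(1-5) [OF assms] by (simp add: bounded_form_def distrib_left)
qed

lemma bounded_form_add:
  assumes "bounded_form B T K" "bounded_form B T' K'"
  shows "bounded_form B (\<lambda>a b. T a b + T' a b) (K + K')"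
proof -
  have "cmod (T a b + T' a b) \<le> (K + K') * na_norm B a * na_norm B b"
    if "a \<in> na_carrier B" "b \<in> na_carrier B" for a b
    using norm_triangle_mono [OF bounded_formD(6) [OF assms(1) that] bounded_formD(6) [OF assms(2) that]]
    by (simp add: distrib_right)
  then show ?thesis
    using bounded_formD(1-5) [OF assms(1)] bounded_formD(1-5) [OF assms(2)]
    by (simp add: bounded_form_def distrib_left)
qed

lemma dual_spaceI:
  assumes "\<And>x y. \<phi> (x + y) = \<phi> x + \<phi> y" and "\<And>c x. \<phi> (c *\<^sub>C x) = c * \<phi> x"
    and "\<And>x. cmod (\<phi> x) \<le> K * norm x"
  shows "\<phi> \<in> dual_space"
proof -
  have "\<phi> (r *\<^sub>R x) = r *\<^sub>R \<phi> x" for r x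
    using assms(2) [of "of_real r" x] by (simp add: scaleC_of_real scaleR_conv_of_real)
  then have "bounded_linear \<phi>"
    using assms by (intro bounded_linear_intro [of _ K]) (simp_all add: mult.commute)
  then show ?thesis
    using assms(2) by (simp add: dual_space_def)
qed

context banach_algebra
begin

lemmas closed = zero_closed add_closed scale_closed mult_closed

lemma bounded_form_cong:
  assumes "bounded_form B T K"
    and "\<And>a b. a \<in> na_carrier B \<Longrightarrow> b \<in> na_carrier B \<Longrightarrow> T a b = T' a b"
  shows "bounded_form B T' K"
  using assms(1) unfolding bounded_form_def by (simp add: assms(2) [symmetric] closed)

text \<open>M acts on total functions; two forms that agree on the carrier differ by a form of bound
  0, which M annihilates because it is bounded.\<close>

lemma virtual_diagonal_cong:
  assumes M: "virtual_diagonal B M" and T: "bounded_form B T K"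
    and eq: "\<And>a b. a \<in> na_carrier B \<Longrightarrow> b \<in> na_carrier B \<Longrightarrow> T a b = T' a b"
  shows "M T = M T'"
proof -
  have T': "bounded_form B T' K"
    using T eq by (rule bounded_form_cong)
  note T'' = bounded_form_scale [OF T', of "-1"]
  obtain C where C: "\<And>T K. bounded_form B T K \<Longrightarrow> cmod (M T) \<le> C * K"
    using virtual_diagonal_bound [OF M] by blast
  have "bounded_form B (\<lambda>a b. T a b + -1 * T' a b) 0"
    using bounded_formD [OF T] by (simp add: bounded_form_def closed eq [symmetric])
  then have "cmod (M (\<lambda>a b. T a b + -1 * T' a b)) \<le> C * 0"
    by (rule C)
  then have "M (\<lambda>a b. T a b + -1 * T' a b) = 0"
    by simp
  then have "M T + -1 * M T' = 0"
    unfolding virtual_diagonal_add [OF M T T''] virtual_diagonal_scale [OF M T'] .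
  then show ?thesis
    by simp
qed

lemma bounded_functional_mult_form:
  assumes f: "bounded_functional B f K" shows "bounded_form B (\<lambda>a b. f (na_mult B a b)) K"
proof -
  note f = bounded_functionalD [OF f]
  have "cmod (f (na_mult B a b)) \<le> K * na_norm B a * na_norm B b"
    if "a \<in> na_carrier B" "b \<in> na_carrier B" for a b
    using f(4) [OF mult_closed [OF that]] mult_left_mono [OF norm_mult [OF that] f(1)]
    by (simp add: mult.assoc)
  then show ?thesis
    using f by (simp add: bounded_form_def closed mult_add_left mult_add_right
        mult_scale_left mult_scale_right)
qed

text \<open>Both functionals of Johnson's argument, \<open>\<phi>\<close> and \<open>\<psi>\<close>
  in \<open>virtual_diagonal_imp_inner\<close>, arise in this way.\<close>

lemma virtual_diagonal_dual:
  fixes T :: "'e::complex_banach \<Rightarrow> 'b \<Rightarrow> 'b \<Rightarrow> complex"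
  assumes M: "virtual_diagonal B M" and T: "\<And>x. bounded_form B (T x) (K * norm x)"
    and add: "\<And>x y a b. a \<in> na_carrier B \<Longrightarrow> b \<in> na_carrier B \<Longrightarrow> T (x + y) a b = T x a b + T y a b"
    and scale: "\<And>c x a b. a \<in> na_carrier B \<Longrightarrow> b \<in> na_carrier B \<Longrightarrow> T (c *\<^sub>C x) a b = c * T x a b"
  shows "(\<lambda>x. M (T x)) \<in> dual_space"
proof -
  obtain C where C: "\<And>T K. bounded_form B T K \<Longrightarrow> cmod (M T) \<le> C * K"
    using virtual_diagonal_bound [OF M] by blast
  show ?thesis
  proof (rule dual_spaceI [where K = "C * K"])
    fix x y
    have "M (T (x + y)) = M (\<lambda>a b. T x a b + T y a b)"
      using M T add by (rule virtual_diagonal_cong)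
    then show "M (T (x + y)) = M (T x) + M (T y)"
      using virtual_diagonal_add [OF M T T] by simp
  next
    fix c x
    have "M (T (c *\<^sub>C x)) = M (\<lambda>a b. c * T x a b)"
      using M T scale by (rule virtual_diagonal_cong)
    then show "M (T (c *\<^sub>C x)) = c * M (T x)"
      using virtual_diagonal_scale [OF M T] by simp
  next
    fix x
    show "cmod (M (T x)) \<le> C * K * norm x"
      using C [OF T [of x]] by (simp add: mult.assoc)
  qed
qed

end

lemma dual_space_add: "\<phi> \<in> dual_space \<Longrightarrow> \<phi> (x + y) = \<phi> x + \<phi> y"
  and dual_space_scaleC: "\<phi> \<in> dual_space \<Longrightarrow> \<phi> (c *\<^sub>C x) = c * \<phi> x"
  and dual_space_bound: "\<phi> \<in> dual_space \<Longrightarrow> cmod (\<phi> x) \<le> onorm \<phi> * norm x"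
  by (auto simp: dual_space_def bounded_linear.linear linear_add intro: onorm)

lemma dual_spaceE:
  assumes "\<phi> \<in> dual_space"
  obtains K where "0 \<le> K" "\<And>x. cmod (\<phi> x) \<le> K * norm x"
  using assms by (metis (no_types) dual_space_bound dual_space_def mem_Collect_eq onorm_pos_le)

text \<open>Johnson's argument: the functional \<open>x \<mapsto> M (D b (x \<cdot> a))\<close> implements \<open>D\<close> up to a
  derivation \<open>D\<^sub>0\<close> with \<open>b \<cdot> D\<^sub>0 c = 0\<close>, which is then implemented by the limit of \<open>- D\<^sub>0\<close> along the
  approximate identity given by \<open>M\<close>.  The second step makes up for bimodules that are
  not essential.\<close>

theorem (in banach_bimodule) virtual_diagonal_imp_inner:
  assumes M: "virtual_diagonal B M" and D: "bounded_derivation B l r D"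
  shows "inner_derivation B l r D"
proof -
  let ?B = "na_carrier B" and ?mult = "na_mult B"
  have abs_mono: "y \<le> \<bar>k\<bar> * n * m" if "y \<le> k * n * m" "0 \<le> n" "0 \<le> m" for y k n m :: real
    using that(1) by (rule order.trans) (intro mult_right_mono that abs_ge_self)
  obtain Kl where Kl: "\<forall>b\<in>?B. \<forall>x. norm (l b x) \<le> Kl * na_norm B b * norm x"
    using l_bounded by blast
  \<comment> \<open>The module axioms do not exclude a negative constant.\<close>
  define L where "L = \<bar>Kl\<bar>"
  have L0: "L \<ge> 0"
    by (simp add: L_def)
  have L: "norm (l b x) \<le> L * na_norm B b * norm x" if "b \<in> ?B" for b x
    unfolding L_def using Kl that norm_nonneg [OF that] by (intro abs_mono) auto
  obtain Kr where Kr: "\<forall>b\<in>?B. \<forall>x. norm (r x b) \<le> Kr * na_norm B b * norm x"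
    using r_bounded by blast
  define R where "R = \<bar>Kr\<bar>"
  have R0: "R \<ge> 0"
    by (simp add: R_def)
  have R: "norm (r x b) \<le> R * na_norm B b * norm x" if "b \<in> ?B" for b x
    unfolding R_def using Kr that norm_nonneg [OF that] by (intro abs_mono) auto
  obtain Kd where Kd: "\<forall>b\<in>?B. onorm (D b) \<le> Kd * na_norm B b"
    using D unfolding bounded_derivation_def by blast
  have Ddual: "D b \<in> dual_space" if "b \<in> ?B" for b
    using D that unfolding bounded_derivation_def by blast
  define P where "P = \<bar>Kd\<bar>"
  have P0: "P \<ge> 0"
    by (simp add: P_def)
  have P: "cmod (D b x) \<le> P * na_norm B b * norm x" if "b \<in> ?B" for b x
  proof -
    have "onorm (D b) \<le> P * na_norm B b"
      unfolding P_def using abs_mono [of _ Kd "na_norm B b" 1] Kd that norm_nonneg [OF that] by simp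
    then show ?thesis
      using dual_space_bound [OF Ddual [OF that], of x]
      by (meson mult_right_mono norm_ge_zero order_trans)
  qed
  have Dadd: "D (na_add B a b) x = D a x + D b x"
    and Dmult: "D (?mult a b) x = D b (r x a) + D a (l b x)" if "a \<in> ?B" "b \<in> ?B" for a b x
    using D that unfolding bounded_derivation_def dual_left_def dual_right_def by metis+
  have Dscale: "D (na_scale B c a) x = c * D a x" if "a \<in> ?B" for a c x
    using D that unfolding bounded_derivation_def by metis
  note Dlin = dual_space_add [OF Ddual] dual_space_scaleC [OF Ddual]

  \<comment> \<open>If M were an actual sum of tensors a \<otimes> b, this would be the sum of the
    functionals a . D b, as (a . D b) x = D b (x . a).\<close>
  define \<phi> where "\<phi> x = M (\<lambda>a b. D b (r x a))" for x
  have Tform: "bounded_form B (\<lambda>a b. D b (r x a)) (P * R * norm x)" for x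
  proof -
    have "cmod (D b (r x a)) \<le> P * R * norm x * na_norm B a * na_norm B b"
      if "a \<in> ?B" "b \<in> ?B" for a b
    proof -
      have "cmod (D b (r x a)) \<le> P * na_norm B b * norm (r x a)"
        using P that by blast
      also have "\<dots> \<le> P * na_norm B b * (R * na_norm B a * norm x)"
        using R that P0 norm_nonneg by (intro mult_left_mono) auto
      finally show ?thesis
        by (simp add: algebra_simps)
    qed
    then show ?thesis
      using P0 R0 by (simp add: bounded_form_def closed Dadd Dscale r_na_add r_na_scale Dlin)
  qed
  have \<phi>: "\<phi> \<in> dual_space"
    unfolding \<phi>_def [abs_def]
    using M Tform by (rule virtual_diagonal_dual [where K = "P * R"])
      (simp_all add: r_add r_scale Dlin)
  obtain F where F: "F \<ge> 0" "\<And>x. cmod (\<phi> x) \<le> F * norm x"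
    using dual_spaceE [OF \<phi>] by blast

  \<comment> \<open>D minus the inner derivation of \<open>\<phi>\<close>.\<close>
  define D0 where "D0 c x = D c x - \<phi> (r x c) + \<phi> (l c x)" for c x
  have rfun: "bounded_functional B (\<lambda>b. D c (r x b)) (P * na_norm B c * R * norm x)"
    if "c \<in> ?B" for c x
  proof -
    have "cmod (D c (r x b)) \<le> P * na_norm B c * R * norm x * na_norm B b" if "b \<in> ?B" for b
      using order.trans [OF P [OF \<open>c \<in> ?B\<close>] mult_left_mono [OF R [OF that]]]
        P0 norm_nonneg [OF \<open>c \<in> ?B\<close>] by (simp add: algebra_simps)
    then show ?thesis
      using P0 R0 norm_nonneg [OF that] that
      by (simp add: bounded_functional_def r_na_add r_na_scale Dlin)
  qed
  \<comment> \<open>The swap property moves c to the right factor, where the product rule for D (b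
    c) splits off \<open>\<phi> (l c x)\<close>. What is left is the defect of the approximate
    identity a b acting on x from the right.\<close>
  have D0: "D0 c x = D c x - M (\<lambda>a b. D c (r x (?mult a b)))" if c: "c \<in> ?B" for c x
  proof -
    have "\<phi> (r x c) = M (\<lambda>a b. D b (r x (?mult c a)))"
      unfolding \<phi>_def using M Tform
      by (rule virtual_diagonal_cong) (simp add: r_na_mult c)
    also have "\<dots> = M (\<lambda>a b. D (?mult b c) (r x a))"
      using virtual_diagonal_swap [OF M Tform c] .
    also have "\<dots> = M (\<lambda>a b. D c (r x (?mult a b)) + D b (r (l c x) a))"
    proof (rule virtual_diagonal_cong [OF M, symmetric])
      show "bounded_form B (\<lambda>a b. D c (r x (?mult a b)) + D b (r (l c x) a))
          (P * na_norm B c * R * norm x + P * R * norm (l c x))"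
        by (intro bounded_form_add bounded_functional_mult_form rfun c Tform)
      show "D c (r x (?mult a b)) + D b (r (l c x) a) = D (?mult b c) (r x a)"
        if "a \<in> ?B" "b \<in> ?B" for a b
        using that c by (simp add: Dmult r_na_mult l_r)
    qed
    also have "\<dots> = M (\<lambda>a b. D c (r x (?mult a b))) + \<phi> (l c x)"
      unfolding \<phi>_def
      by (rule virtual_diagonal_add [OF M bounded_functional_mult_form [OF rfun [OF c]] Tform])
    finally show ?thesis
      by (simp add: D0_def)
  qed
  \<comment> \<open>On x . b that defect vanishes, by the right unit property of M.\<close>
  have D0_right: "D0 c (r x b) = 0" if "c \<in> ?B" "b \<in> ?B" for c b x
  proof -
    have "M (\<lambda>a d. D c (r (r x b) (?mult a d))) = M (\<lambda>a d. D c (r x (?mult b (?mult a d))))"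
      by (rule virtual_diagonal_cong [OF M bounded_functional_mult_form [OF rfun]])
        (simp_all add: that closed r_na_mult)
    also have "\<dots> = D c (r x b)"
      using virtual_diagonal_right_unit [OF M rfun] that by blast
    finally show ?thesis
      using that by (simp add: D0)
  qed
  \<comment> \<open>\<open>D0\<close> is a derivation, and one of the two terms of its product rule
    is \<open>D0 c (r x b) = 0\<close>.\<close>
  have D0_mult: "D0 (?mult b c) x = D0 b (l c x)" if "c \<in> ?B" "b \<in> ?B" for c b x
    using D0_right [OF that, of x] that
    by (simp add: D0_def Dmult r_na_mult l_na_mult l_r eq_neg_iff_add_eq_0)
  define K where "K = P + F * R + F * L"
  have D0_bound: "cmod (D0 c x) \<le> K * na_norm B c * norm x" if "c \<in> ?B" for c x
  proof -
    have "cmod (\<phi> (r x c)) \<le> F * (R * na_norm B c * norm x)"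
      using F R [OF that] by (meson mult_left_mono order_trans)
    moreover have "cmod (\<phi> (l c x)) \<le> F * (L * na_norm B c * norm x)"
      using F L [OF that] by (meson mult_left_mono order_trans)
    moreover have "cmod (D0 c x) \<le> cmod (D c x) + cmod (\<phi> (r x c)) + cmod (\<phi> (l c x))"
      unfolding D0_def using norm_triangle_ineq4 norm_triangle_ineq add_right_mono order_trans
      by (metis (no_types, lifting))
    ultimately show ?thesis
      using P [OF that, of x] by (simp add: K_def algebra_simps)
  qed
  have K0: "K \<ge> 0"
    using P0 F(1) R0 by (simp add: K_def L0)
  have fun0: "bounded_functional B (\<lambda>c. D0 c x) (K * norm x)" for x
    using D0_bound [of _ x] K0
    by (simp add: bounded_functional_def D0_def Dadd Dscale r_na_add r_na_scale l_na_add l_na_scale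
        dual_space_add [OF \<phi>] dual_space_scaleC [OF \<phi>] algebra_simps)
  \<comment> \<open>The inner derivation of \<open>- \<psi>\<close> is
    \<open>\<psi> (l c x) - \<psi> (r x c)\<close>; \<open>\<psi>_left\<close> and
    \<open>\<psi>_right\<close> identify it with \<open>D0 c x\<close>.\<close>
  define \<psi> where "\<psi> x = M (\<lambda>a b. D0 (?mult a b) x)" for x
  have \<psi>: "\<psi> \<in> dual_space"
    unfolding \<psi>_def [abs_def]
    using M bounded_functional_mult_form [OF fun0]
    by (rule virtual_diagonal_dual)
      (simp_all add: D0_def closed Dlin r_add r_scale l_add l_scale
        dual_space_add [OF \<phi>] dual_space_scaleC [OF \<phi>] algebra_simps)
  have \<psi>_left: "\<psi> (l c x) = D0 c x" if c: "c \<in> ?B" for c x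
  proof -
    have "\<psi> (l c x) = M (\<lambda>a b. D0 (?mult (?mult a b) c) x)"
      unfolding \<psi>_def
      by (rule virtual_diagonal_cong [OF M bounded_functional_mult_form [OF fun0]])
        (simp add: c D0_mult closed)
    also have "\<dots> = D0 c x"
      by (rule virtual_diagonal_left_unit [OF M fun0 c])
    finally show ?thesis .
  qed
  have \<psi>_right: "\<psi> (r x c) = 0" if c: "c \<in> ?B" for c x
  proof -
    have "\<psi> (r x c) = M (\<lambda>a b. 0 * D0 (?mult a b) x)"
      unfolding \<psi>_def
      by (rule virtual_diagonal_cong [OF M bounded_functional_mult_form [OF fun0]])
        (simp add: c D0_right closed)
    then show ?thesis
      using virtual_diagonal_scale [OF M bounded_functional_mult_form [OF fun0], of 0 x] by simp
  qed
  obtain G where G: "G \<ge> 0" "\<And>x. cmod (\<psi> x) \<le> G * norm x"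
    using dual_spaceE [OF \<psi>] by blast
  have "(\<lambda>x. \<phi> x - \<psi> x) \<in> dual_space"
  proof (rule dual_spaceI [where K = "F + G"])
    show "cmod (\<phi> x - \<psi> x) \<le> (F + G) * norm x" for x
      using norm_triangle_ineq4 [of "\<phi> x" "\<psi> x"] F(2) [of x] G(2) [of x]
      by (simp add: distrib_right)
  qed (simp_all add: dual_space_add [OF \<phi>] dual_space_add [OF \<psi>]
      dual_space_scaleC [OF \<phi>] dual_space_scaleC [OF \<psi>] algebra_simps)
  moreover have "D c = (\<lambda>x. dual_left r c (\<lambda>x. \<phi> x - \<psi> x) x - dual_right l (\<lambda>x. \<phi> x - \<psi> x) c x)"
    if "c \<in> ?B" for c
    using \<psi>_left [OF that] \<psi>_right [OF that]
    by (auto simp: dual_left_def dual_right_def D0_def)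
  ultimately show ?thesis
    unfolding inner_derivation_def by blast
qed

context banach_algebra
begin

lemma bounded_form_mult_left:
  assumes T: "bounded_form B T K" and c: "c \<in> na_carrier B"
  shows "bounded_form B (\<lambda>a b. T (na_mult B c a) b) (K * na_norm B c)"
proof -
  note T = bounded_formD [OF T]
  have "cmod (T (na_mult B c a) b) \<le> K * na_norm B c * na_norm B a * na_norm B b"
    if ab: "a \<in> na_carrier B" "b \<in> na_carrier B" for a b
  proof -
    have "cmod (T (na_mult B c a) b) \<le> K * na_norm B (na_mult B c a) * na_norm B b"
      using T(6) c ab mult_closed by blast
    also have "\<dots> \<le> K * (na_norm B c * na_norm B a) * na_norm B b"
      by (intro mult_right_mono mult_left_mono norm_mult norm_nonneg c ab T)
    finally show ?thesis
      by (simp add: mult.assoc)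
  qed
  then show ?thesis
    using T(1-5) c
    by (simp add: bounded_form_def closed mult_add_right mult_scale_right norm_nonneg)
qed

lemma bounded_form_mult_right:
  assumes T: "bounded_form B T K" and c: "c \<in> na_carrier B"
  shows "bounded_form B (\<lambda>a b. T a (na_mult B b c)) (K * na_norm B c)"
proof -
  note T = bounded_formD [OF T]
  have "cmod (T a (na_mult B b c)) \<le> K * na_norm B c * na_norm B a * na_norm B b"
    if ab: "a \<in> na_carrier B" "b \<in> na_carrier B" for a b
  proof -
    have "cmod (T a (na_mult B b c)) \<le> K * na_norm B a * na_norm B (na_mult B b c)"
      using T(6) c ab mult_closed by blast
    also have "\<dots> \<le> K * na_norm B a * (na_norm B b * na_norm B c)"
      by (intro mult_left_mono norm_mult mult_nonneg_nonneg norm_nonneg c ab T)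
    finally show ?thesis
      by (simp add: mult_ac)
  qed
  then show ?thesis
    using T(1-5) c
    by (simp add: bounded_form_def closed mult_add_left mult_scale_left norm_nonneg)
qed

lemma bounded_functional_mult_left:
  assumes f: "bounded_functional B f K" and c: "c \<in> na_carrier B"
  shows "bounded_functional B (\<lambda>a. f (na_mult B c a)) (K * na_norm B c)"
proof -
  note f = bounded_functionalD [OF f]
  have "cmod (f (na_mult B c a)) \<le> K * na_norm B c * na_norm B a" if a: "a \<in> na_carrier B" for a
    using f(4) [OF mult_closed [OF c a]] mult_left_mono [OF norm_mult [OF c a] f(1)]
    by (simp add: mult.assoc)
  then show ?thesis
    using f(1-3) c
    by (simp add: bounded_functional_def closed mult_add_right mult_scale_right norm_nonneg)
qed

lemma bounded_functional_mult_right: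
  assumes f: "bounded_functional B f K" and c: "c \<in> na_carrier B"
  shows "bounded_functional B (\<lambda>a. f (na_mult B a c)) (K * na_norm B c)"
proof -
  note f = bounded_functionalD [OF f]
  have "cmod (f (na_mult B a c)) \<le> K * na_norm B c * na_norm B a" if a: "a \<in> na_carrier B" for a
    using f(4) [OF mult_closed [OF a c]] mult_left_mono [OF norm_mult [OF a c] f(1)]
    by (simp add: mult_ac)
  then show ?thesis
    using f(1-3) c
    by (simp add: bounded_functional_def closed mult_add_left mult_scale_left norm_nonneg)
qed

end

section \<open>The coefficient algebra as a Banach algebra with explicit carrier\<close>

definition self_algebra :: "'a::cstar_algebra normed_alg" where
  "self_algebra = \<lparr> na_carrier = UNIV, na_zero = 0, na_add = (+), na_scale = scaleC,
     na_mult = (*), na_norm = norm \<rparr>"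

lemma self_algebra_simps [simp]:
  "na_carrier self_algebra = UNIV" "na_zero self_algebra = 0" "na_add self_algebra = (+)"
  "na_scale self_algebra = scaleC" "na_mult self_algebra = (*)" "na_norm self_algebra = norm"
  "na_diff self_algebra = (-)"
  by (simp_all add: self_algebra_def na_diff_def fun_eq_iff scaleC_minus_left)

lemma banach_algebra_self: "banach_algebra (self_algebra :: 'a::cstar_algebra normed_alg)"
proof
  fix s :: "nat \<Rightarrow> 'a"
  assume "\<And>e. 0 < e \<Longrightarrow>
    \<exists>N. \<forall>m\<ge>N. \<forall>n\<ge>N. na_norm self_algebra (na_diff self_algebra (s m) (s n)) < e"
  then have "Cauchy s"
    by (simp add: Cauchy_def dist_norm)
  then obtain a where "s \<longlonglongrightarrow> a"
    using Cauchy_convergent convergent_def by blast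
  then have "(\<lambda>n. norm (s n - a)) \<longlonglongrightarrow> 0"
    by (simp add: LIM_zero tendsto_norm_zero)
  then show "\<exists>a\<in>na_carrier self_algebra.
      (\<lambda>n. na_norm self_algebra (na_diff self_algebra (s n) a)) \<longlonglongrightarrow> 0"
    by auto
qed (simp_all add: scaleC_add_right scaleC_add_left scaleC_scaleC scaleC_mult_left
    scaleC_mult_right norm_scaleC norm_triangle_ineq norm_mult_ineq add_ac distrib_left
    distrib_right mult.assoc)

lemma is_mean_imp_mean_on:
  assumes m: "is_mean m" shows "mean_on UNIV m"
  unfolding mean_on_def
proof (intro conjI allI impI)
  fix f :: "'a \<Rightarrow> complex" and K assume f: "\<forall>x\<in>UNIV. cmod (f x) \<le> K"
  then have "f \<in> linf"
    by (auto simp: linf_def bounded_iff)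
  then have "cmod (m f) \<le> (SUP h. cmod (f h))"
    using m by (simp add: is_mean_def)
  also have "\<dots> \<le> K"
    using f by (intro cSUP_least) auto
  finally show "cmod (m f) \<le> K" .
qed (use m in \<open>simp_all add: is_mean_def linf_def\<close>)

lemma ell1_single_add: "ell1_single g (x + y) = (\<lambda>h. ell1_single g x h + ell1_single g y h)"
  by (auto simp: ell1_single_def)

lemma ell1_single_scaleC:
  "ell1_single g (c *\<^sub>C x) = (\<lambda>h. c *\<^sub>C ell1_single g (x::'v::complex_banach) h)"
  by (auto simp: ell1_single_def)

section \<open>From a diagonal of the coefficient algebra to one of the crossed product\<close>

context cstar_system
begin

interpretation L: banach_algebra "l1_algebra \<alpha>"
  by (rule banach_algebra_l1)

interpretation A: banach_algebra "self_algebra :: 'a normed_alg"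
  by (rule banach_algebra_self)

text \<open>\<open>ell1_single g (\<alpha> g a)\<close> is the point mass at g times a, in this
  order. The bound K survives because the action is contractive and point masses embed
  isometrically.\<close>

lemma bounded_form_single:
  assumes T: "bounded_form (l1_algebra \<alpha>) T K"
  shows "bounded_form self_algebra
    (\<lambda>a b. T (ell1_single g (\<alpha> g a)) (ell1_single k b)) K"
proof -
  note T = bounded_formD [OF T, simplified]
  have "cmod (T (ell1_single g (\<alpha> g a)) (ell1_single k b)) \<le> K * norm a * norm b" for a b
  proof -
    have "cmod (T (ell1_single g (\<alpha> g a)) (ell1_single k b)) \<le> K * norm (\<alpha> g a) * norm b"
      using T(6) [OF ell1_single(1) ell1_single(1), of g "\<alpha> g a" k b] by (simp add: ell1_single)
    also have "\<dots> \<le> K * norm a * norm b"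
      by (intro mult_right_mono mult_left_mono act_norm_le T(1)) simp
    finally show ?thesis .
  qed
  then show ?thesis
    using T(1-5)
    by (simp add: bounded_form_def act_add act_scaleC ell1_single_add ell1_single_scaleC ell1_single)
qed

lemma bounded_functional_single:
  assumes f: "bounded_functional (l1_algebra \<alpha>) f K"
  shows "bounded_functional self_algebra (\<lambda>a. f (ell1_single h (\<alpha> g a))) K"
proof -
  note f = bounded_functionalD [OF f, simplified]
  have "cmod (f (ell1_single h (\<alpha> g a))) \<le> K * norm a" for a
    using f(4) [OF ell1_single(1), of h "\<alpha> g a"] mult_left_mono [OF act_norm_le f(1), of g a]
    by (simp add: ell1_single)
  then show ?thesis
    using f(1-3)
    by (simp add: bounded_functional_def act_add act_scaleC ell1_single_add ell1_single_scaleC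
        ell1_single)
qed

text \<open>Averages the diagonal of \<open>A\<close>, transported to \<open>\<delta>\<^sub>g A \<times> A \<delta>\<^sub>g\<^sup>-\<^sup>1\<close>, over \<open>g\<close>.  Placing \<open>\<delta>\<^sub>g\<close>
  outside of the two factors avoids any invariance assumption on \<open>M\<close>.\<close>

definition crossed_diagonal ::
  "(('g \<Rightarrow> complex) \<Rightarrow> complex) \<Rightarrow> (('a \<Rightarrow> 'a \<Rightarrow> complex) \<Rightarrow> complex) \<Rightarrow>
   (('g \<Rightarrow> 'a) \<Rightarrow> ('g \<Rightarrow> 'a) \<Rightarrow> complex) \<Rightarrow> complex" where
  "crossed_diagonal m M T =
     m (\<lambda>g. M (\<lambda>a b. T (ell1_single g (\<alpha> g a)) (ell1_single (- g) b)))"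

lemma crossed_diagonal_cong:
  assumes "\<And>a b. a \<in> ell1 \<Longrightarrow> b \<in> ell1 \<Longrightarrow> T a b = T' a b"
  shows "crossed_diagonal m M T = crossed_diagonal m M T'"
  using assms by (simp add: crossed_diagonal_def ell1_single)

context
  fixes m :: "('g \<Rightarrow> complex) \<Rightarrow> complex" and M :: "('a \<Rightarrow> 'a \<Rightarrow> complex) \<Rightarrow> complex" and C :: real
  assumes m: "is_mean m" "left_invariant m" and M: "virtual_diagonal self_algebra M"
    and C: "0 \<le> C" "\<And>T K. bounded_form self_algebra T K \<Longrightarrow> cmod (M T) \<le> C * K"
begin

lemmas m_mean = is_mean_imp_mean_on [OF m(1)]

text \<open>The mean m is additive only on bounded functions.\<close>

lemma crossed_bounded:
  assumes "bounded_form (l1_algebra \<alpha>) T K"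
  shows "bounded (range (\<lambda>g. M (\<lambda>a b. T (ell1_single g (\<alpha> g a)) (ell1_single (- g) b))))"
  using C(2) [OF bounded_form_single [OF assms]] by (auto simp: bounded_iff)

lemma crossed_diagonal_bound:
  "bounded_form (l1_algebra \<alpha>) T K \<Longrightarrow> cmod (crossed_diagonal m M T) \<le> C * K"
  unfolding crossed_diagonal_def
  by (intro mean_on_bound [OF m_mean] C bounded_form_single)

lemma crossed_diagonal_add:
  assumes "bounded_form (l1_algebra \<alpha>) T K" "bounded_form (l1_algebra \<alpha>) T' K'"
  shows "crossed_diagonal m M (\<lambda>a b. T a b + T' a b) = crossed_diagonal m M T + crossed_diagonal m M T'"
  unfolding crossed_diagonal_def
  by (simp add: virtual_diagonal_add [OF M bounded_form_single [OF assms(1)] bounded_form_single [OF assms(2)]]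
      mean_on_add [OF m_mean] crossed_bounded [OF assms(1)] crossed_bounded [OF assms(2)])

lemma crossed_diagonal_scale:
  assumes "bounded_form (l1_algebra \<alpha>) T K"
  shows "crossed_diagonal m M (\<lambda>a b. c * T a b) = c * crossed_diagonal m M T"
  unfolding crossed_diagonal_def
  by (simp add: virtual_diagonal_scale [OF M bounded_form_single [OF assms]]
      mean_on_scale [OF m_mean] crossed_bounded [OF assms])

text \<open>Multiplication by y at h from the left replaces g by h + g, which the invariance of m
  absorbs, and puts \<open>\<alpha> (- g) y\<close> in front of a, which the diagonal of A carries
  over to b.\<close>

lemma crossed_diagonal_swap_single:
  assumes T: "bounded_form (l1_algebra \<alpha>) T K"
  shows "crossed_diagonal m M (\<lambda>a b. T (conv (ell1_single h y) a) b) =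
    crossed_diagonal m M (\<lambda>a b. T a (conv b (ell1_single h y)))"
proof -
  define G where "G k = M (\<lambda>a b. T (ell1_single k (y * \<alpha> k a)) (ell1_single (- k + h) b))" for k
  have G: "M (\<lambda>a b. T (ell1_single g (\<alpha> g (\<alpha> (- g) y * a))) (ell1_single (- g + h) b)) = G g" for g
    by (simp add: G_def act_mult)
  \<comment> \<open>The coefficient \<open>\<alpha> (- g) y\<close> varies with g; contractivity of
    the action makes the bound uniform.\<close>
  have "cmod (G g) \<le> C * (K * norm y)" for g
  proof -
    have "cmod (G g) \<le> C * (K * norm (\<alpha> (- g) y))"
      using C(2) [OF A.bounded_form_mult_left [OF bounded_form_single [OF T, of g "- g + h"]], of "\<alpha> (- g) y"]
      by (simp add: G)
    also have "\<dots> \<le> C * (K * norm y)"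
      by (intro mult_left_mono act_norm_le C bounded_formD(1) [OF T])
    finally show ?thesis .
  qed
  then have "G \<in> linf"
    by (auto simp: linf_def bounded_iff)
  have minus: "- (h + g) + h = - g" for g
    by (simp add: minus_add add.assoc del: add_uminus_conv_diff)
  have "crossed_diagonal m M (\<lambda>a b. T (conv (ell1_single h y) a) b) = m (\<lambda>g. G (h + g))"
    unfolding crossed_diagonal_def conv_single_single G_def minus by (simp add: act_plus)
  also have "\<dots> = m G"
    using m(2) \<open>G \<in> linf\<close> unfolding left_invariant_def by (metis minus_minus)
  also have "\<dots> = crossed_diagonal m M (\<lambda>a b. T a (conv b (ell1_single h y)))"
  proof -
    have "G g = M (\<lambda>a b. T (ell1_single g (\<alpha> g a)) (ell1_single (- g + h) (b * \<alpha> (- g) y)))" for g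
      using virtual_diagonal_swap [OF M bounded_form_single [OF T, of g "- g + h"], of "\<alpha> (- g) y"]
      by (simp add: G)
    then have "G = (\<lambda>g. M (\<lambda>a b. T (ell1_single g (\<alpha> g a))
        (ell1_single (- g + h) (b * \<alpha> (- g) y))))" ..
    then show ?thesis
      unfolding crossed_diagonal_def conv_single_single by (rule arg_cong)
  qed
  finally show ?thesis .
qed

text \<open>Both sides are additive in c and bounded by \<open>C * K * ell1_norm c\<close>, so point
  masses suffice.\<close>

lemma crossed_diagonal_swap:
  assumes T: "bounded_form (l1_algebra \<alpha>) T K" and c: "c \<in> ell1"
  shows "crossed_diagonal m M (\<lambda>a b. T (conv c a) b) = crossed_diagonal m M (\<lambda>a b. T a (conv b c))"
proof -
  note left = L.bounded_form_mult_left [OF T, simplified]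
    and right = L.bounded_form_mult_right [OF T, simplified]
  note T' = bounded_formD [OF T, simplified]
  show ?thesis
  proof (rule ell1_eqI [where F = "\<lambda>c. crossed_diagonal m M (\<lambda>a b. T (conv c a) b)"
        and F' = "\<lambda>c. crossed_diagonal m M (\<lambda>a b. T a (conv b c))"
        and K = "C * K" and K' = "C * K"])
    fix c d :: "'g \<Rightarrow> 'a" assume c: "c \<in> ell1" and d: "d \<in> ell1"
    show "crossed_diagonal m M (\<lambda>a b. T (conv (\<lambda>g. c g + d g) a) b) =
        crossed_diagonal m M (\<lambda>a b. T (conv c a) b) + crossed_diagonal m M (\<lambda>a b. T (conv d a) b)"
      unfolding crossed_diagonal_add [OF left [OF c] left [OF d], symmetric]
      by (rule crossed_diagonal_cong) (simp add: conv_add_left c d T' conv_summable)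
    show "crossed_diagonal m M (\<lambda>a b. T a (conv b (\<lambda>g. c g + d g))) =
        crossed_diagonal m M (\<lambda>a b. T a (conv b c)) + crossed_diagonal m M (\<lambda>a b. T a (conv b d))"
      unfolding crossed_diagonal_add [OF right [OF c] right [OF d], symmetric]
      by (rule crossed_diagonal_cong) (simp add: conv_add_right c d T' conv_summable)
    show "cmod (crossed_diagonal m M (\<lambda>a b. T (conv c a) b)) \<le> C * K * ell1_norm c"
      using crossed_diagonal_bound [OF left [OF c]] by (simp add: mult.assoc)
    show "cmod (crossed_diagonal m M (\<lambda>a b. T a (conv b c))) \<le> C * K * ell1_norm c"
      using crossed_diagonal_bound [OF right [OF c]] by (simp add: mult.assoc)
  qed (use crossed_diagonal_swap_single [OF T] c in auto)
qed

text \<open>The two point masses under the mean multiply to \<open>\<alpha> g (a * b)\<close> at 0.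
  So for a point mass c the left unit property of M gives, at each g, the same value
  \<open>f c\<close>.\<close>

lemma crossed_diagonal_left_unit:
  assumes f: "bounded_functional (l1_algebra \<alpha>) f K" and c: "c \<in> ell1"
  shows "crossed_diagonal m M (\<lambda>a b. f (conv (conv a b) c)) = f c"
proof -
  note form = L.bounded_functional_mult_form [OF L.bounded_functional_mult_right [OF f], simplified]
  note f' = bounded_functionalD [OF f, simplified]
  show ?thesis
  proof (rule ell1_eqI [where F = "\<lambda>c. crossed_diagonal m M (\<lambda>a b. f (conv (conv a b) c))"
        and K = "C * K" and K' = K])
    fix c d :: "'g \<Rightarrow> 'a" assume c: "c \<in> ell1" and d: "d \<in> ell1"
    show "crossed_diagonal m M (\<lambda>a b. f (conv (conv a b) (\<lambda>g. c g + d g))) =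
        crossed_diagonal m M (\<lambda>a b. f (conv (conv a b) c)) +
        crossed_diagonal m M (\<lambda>a b. f (conv (conv a b) d))"
      unfolding crossed_diagonal_add [OF form [OF c] form [OF d], symmetric]
      by (rule crossed_diagonal_cong) (simp add: conv_add_right c d f' conv_summable)
    show "cmod (crossed_diagonal m M (\<lambda>a b. f (conv (conv a b) c))) \<le> C * K * ell1_norm c"
      using crossed_diagonal_bound [OF form [OF c]] by (simp add: mult.assoc)
  next
    fix h y
    have "M (\<lambda>a b. f (conv (conv (ell1_single g (\<alpha> g a)) (ell1_single (- g) b)) (ell1_single h y))) =
        f (ell1_single h y)" for g
      using virtual_diagonal_left_unit [OF M bounded_functional_single [OF f], of "\<alpha> (- g) y" h g]
      by (simp add: conv_single_single act_mult mult.assoc)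
    then show "crossed_diagonal m M (\<lambda>a b. f (conv (conv a b) (ell1_single h y))) = f (ell1_single h y)"
      by (simp add: crossed_diagonal_def mean_on_const [OF m_mean])
  qed (use f' c in auto)
qed

lemma crossed_diagonal_right_unit:
  assumes f: "bounded_functional (l1_algebra \<alpha>) f K" and c: "c \<in> ell1"
  shows "crossed_diagonal m M (\<lambda>a b. f (conv c (conv a b))) = f c"
proof -
  note form = L.bounded_functional_mult_form [OF L.bounded_functional_mult_left [OF f], simplified]
  note f' = bounded_functionalD [OF f, simplified]
  show ?thesis
  proof (rule ell1_eqI [where F = "\<lambda>c. crossed_diagonal m M (\<lambda>a b. f (conv c (conv a b)))"
        and K = "C * K" and K' = K])
    fix c d :: "'g \<Rightarrow> 'a" assume c: "c \<in> ell1" and d: "d \<in> ell1"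
    show "crossed_diagonal m M (\<lambda>a b. f (conv (\<lambda>g. c g + d g) (conv a b))) =
        crossed_diagonal m M (\<lambda>a b. f (conv c (conv a b))) +
        crossed_diagonal m M (\<lambda>a b. f (conv d (conv a b)))"
      unfolding crossed_diagonal_add [OF form [OF c] form [OF d], symmetric]
      by (rule crossed_diagonal_cong) (simp add: conv_add_left c d f' conv_summable)
    show "cmod (crossed_diagonal m M (\<lambda>a b. f (conv c (conv a b)))) \<le> C * K * ell1_norm c"
      using crossed_diagonal_bound [OF form [OF c]] by (simp add: mult.assoc)
  next
    fix h y
    \<comment> \<open>Passing h from the left turns \<open>\<alpha> g (a * b)\<close> into
      \<open>\<alpha> (h + g) (a * b)\<close>, so y is pulled back by h + g here.\<close>
    have "M (\<lambda>a b. f (conv (ell1_single h y) (conv (ell1_single g (\<alpha> g a)) (ell1_single (- g) b)))) =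
        f (ell1_single h y)" for g
      using virtual_diagonal_right_unit [OF M bounded_functional_single [OF f],
          of "\<alpha> (- (h + g)) y" h "h + g"]
      by (simp add: conv_single_single act_mult act_plus del: minus_add)
    then show "crossed_diagonal m M (\<lambda>a b. f (conv (ell1_single h y) (conv a b))) = f (ell1_single h y)"
      by (simp add: crossed_diagonal_def mean_on_const [OF m_mean])
  qed (use f' c in auto)
qed

lemma virtual_diagonal_crossed: "virtual_diagonal (l1_algebra \<alpha>) (crossed_diagonal m M)"
  unfolding virtual_diagonal_def
  using C(1) crossed_diagonal_bound crossed_diagonal_add crossed_diagonal_scale
    crossed_diagonal_swap crossed_diagonal_left_unit crossed_diagonal_right_unit
  by (auto intro!: exI [of _ C])

end

theorem amenable_crossed_product:
  assumes "amenable_group TYPE('g)" and M: "virtual_diagonal (self_algebra :: 'a normed_alg) M"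
  shows "amenable_banach_algebra TYPE('e::complex_banach) (l1_algebra \<alpha>)"
proof -
  obtain m :: "('g \<Rightarrow> complex) \<Rightarrow> complex" where m: "is_mean m" "left_invariant m"
    using assms(1) unfolding amenable_group_def by blast
  obtain C where C: "0 \<le> C" "\<And>T K. bounded_form self_algebra T K \<Longrightarrow> cmod (M T) \<le> C * K"
    using virtual_diagonal_bound [OF M] by blast
  show ?thesis
    unfolding amenable_banach_algebra_def
    using banach_algebra_l1 banach_bimodule.virtual_diagonal_imp_inner
      [OF _ virtual_diagonal_crossed [OF m M C]] by blast
qed

end

section \<open>Commutative C*-algebras\<close>

text \<open>Lets the triple average of the commutative case be treated as one mean. The inner mean
  is known to be additive only at x in X, which is why \<open>mean_on_cong\<close> enters.\<close>

lemma mean_on_prod: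
  assumes \<Lambda>: "mean_on X \<Lambda>" and \<Lambda>': "mean_on Y \<Lambda>'"
  shows "mean_on (X \<times> Y) (\<lambda>F. \<Lambda> (\<lambda>x. \<Lambda>' (\<lambda>y. F (x, y))))"
proof -
  have inner: "bounded ((\<lambda>y. F (x, y)) ` Y)" if "bounded (F ` (X \<times> Y))" "x \<in> X"
    for F :: "'a \<times> 'b \<Rightarrow> complex" and x
    using that by (auto simp: bounded_iff)
  have outer: "bounded ((\<lambda>x. \<Lambda>' (\<lambda>y. F (x, y))) ` X)" if "bounded (F ` (X \<times> Y))"
    for F :: "'a \<times> 'b \<Rightarrow> complex"
    using that mean_on_bound [OF \<Lambda>'] by (fastforce simp: bounded_iff)
  show ?thesis
    unfolding mean_on_def
  proof (intro conjI allI impI)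
    fix F F' :: "'a \<times> 'b \<Rightarrow> complex"
    assume b: "bounded (F ` (X \<times> Y))" "bounded (F' ` (X \<times> Y))"
    have "\<Lambda> (\<lambda>x. \<Lambda>' (\<lambda>y. F (x, y) + F' (x, y))) =
        \<Lambda> (\<lambda>x. \<Lambda>' (\<lambda>y. F (x, y)) + \<Lambda>' (\<lambda>y. F' (x, y)))"
      by (rule mean_on_cong [OF \<Lambda>, symmetric])
        (simp_all add: bounded_image_add outer b mean_on_add [OF \<Lambda>'] inner)
    then show "\<Lambda> (\<lambda>x. \<Lambda>' (\<lambda>y. F (x, y) + F' (x, y))) =
        \<Lambda> (\<lambda>x. \<Lambda>' (\<lambda>y. F (x, y))) + \<Lambda> (\<lambda>x. \<Lambda>' (\<lambda>y. F' (x, y)))"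
      by (simp add: mean_on_add [OF \<Lambda>] outer b)
  next
    fix c and F :: "'a \<times> 'b \<Rightarrow> complex" assume b: "bounded (F ` (X \<times> Y))"
    have "\<Lambda> (\<lambda>x. \<Lambda>' (\<lambda>y. c * F (x, y))) = \<Lambda> (\<lambda>x. c * \<Lambda>' (\<lambda>y. F (x, y)))"
      by (rule mean_on_cong [OF \<Lambda>, symmetric])
        (simp_all add: bounded_image_scale outer b mean_on_scale [OF \<Lambda>'] inner)
    then show "\<Lambda> (\<lambda>x. \<Lambda>' (\<lambda>y. c * F (x, y))) = c * \<Lambda> (\<lambda>x. \<Lambda>' (\<lambda>y. F (x, y)))"
      by (simp add: mean_on_scale [OF \<Lambda>] outer b)
  next
    fix F :: "'a \<times> 'b \<Rightarrow> complex" and K assume "\<forall>z\<in>X \<times> Y. cmod (F z) \<le> K"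
    then show "cmod (\<Lambda> (\<lambda>x. \<Lambda>' (\<lambda>y. F (x, y)))) \<le> K"
      by (intro mean_on_bound [OF \<Lambda>] mean_on_bound [OF \<Lambda>']) auto
  qed (simp add: mean_on_one [OF \<Lambda>] mean_on_one [OF \<Lambda>'])
qed

text \<open>\<open>1 + v \<odot> s = (1 + v) (1 + s)\<close>\<close>

definition circle :: "'a::cstar_algebra \<Rightarrow> 'a \<Rightarrow> 'a" (infixl "\<odot>" 70) where
  "v \<odot> s = v + s + v * s"

context
  assumes comm: "\<forall>x y :: 'a::cstar_algebra. x * y = y * x"
begin

lemma mult_left_comm: "x * (y * z) = y * (x * (z::'a))"
  by (metis comm mult.assoc)

lemma quasi_unitary_circle:
  assumes "quasi_unitary (v::'a)" "quasi_unitary s" shows "quasi_unitary (v \<odot> s)"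
proof -
  \<comment> \<open>\<open>star s + s + star s * s\<close> is star (1 + s) (1 + s) - 1; the right
    hand side sorts the expansion of star (1 + s) star (1 + v) (1 + v) (1 + s) - 1 by these
    defects.\<close>
  have "star (v \<odot> s) + v \<odot> s + star (v \<odot> s) * (v \<odot> s) =
     (star s + s + star s * s) + (star v + v + star v * v) + star s * (star v + v + star v * v)
     + (star v + v + star v * v) * s + star s * (star v + v + star v * v) * s"
    by (simp add: circle_def star_add star_mult algebra_simps)
  then have "star (v \<odot> s) + v \<odot> s + star (v \<odot> s) * (v \<odot> s) = 0"
    using assms by (simp add: quasi_unitary_def)
  then show ?thesis
    using comm by (simp add: quasi_unitary_def)
qed

lemma quasi_unitary_mean:
  obtains \<Lambda> :: "('a \<Rightarrow> complex) \<Rightarrow> complex" where "mean_on (Collect quasi_unitary) \<Lambda>"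
    "\<And>v f. quasi_unitary v \<Longrightarrow> bounded (f ` Collect quasi_unitary) \<Longrightarrow> \<Lambda> (\<lambda>s. f (v \<odot> s)) = \<Lambda> f"
proof (rule commuting_maps_mean [of "Collect quasi_unitary" "(\<odot>) ` Collect quasi_unitary"])
  show "Collect quasi_unitary \<noteq> ({} :: 'a set)"
    using quasi_unitary_zero by blast
  fix T :: "'a \<Rightarrow> 'a" assume T: "T \<in> (\<odot>) ` Collect quasi_unitary"
  then show "T ` Collect quasi_unitary \<subseteq> Collect quasi_unitary"
    using quasi_unitary_circle by auto
  fix T' x assume T': "T' \<in> (\<odot>) ` Collect (quasi_unitary :: 'a \<Rightarrow> bool)"
  from T T' show "T (T' x) = T' (T x)"
    using comm mult_left_comm by (auto simp: circle_def distrib_left distrib_right add_ac mult.assoc)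
next
  fix \<Lambda> :: "('a \<Rightarrow> complex) \<Rightarrow> complex"
  assume "mean_on (Collect quasi_unitary) \<Lambda>"
    and "\<And>T f. T \<in> (\<odot>) ` Collect quasi_unitary \<Longrightarrow> bounded (f ` Collect quasi_unitary) \<Longrightarrow>
      \<Lambda> (\<lambda>x. f (T x)) = \<Lambda> f"
  then show thesis
    using that by blast
qed

context
  fixes \<Lambda> :: "('a \<Rightarrow> complex) \<Rightarrow> complex"
  assumes \<Lambda>: "mean_on (Collect quasi_unitary) \<Lambda>"
    and inv: "\<And>v f. quasi_unitary v \<Longrightarrow> bounded (f ` Collect quasi_unitary) \<Longrightarrow>
      \<Lambda> (\<lambda>s. f (v \<odot> s)) = \<Lambda> f"
begin

interpretation A: banach_algebra "self_algebra :: 'a normed_alg"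
  by (rule banach_algebra_self)

text \<open>The mean of the unitaries \<open>1 + s\<close> annihilates the algebra, so that \<open>- s\<close> is an
  approximate identity in the mean.\<close>

lemma mean_quasi_unitary:
  assumes f: "bounded_functional self_algebra f K"
  shows "\<Lambda> (\<lambda>s. f (s * c)) = - f c"
proof -
  note f' = bounded_functionalD [OF f, simplified]
  have bd: "bounded ((\<lambda>s. f (s * c)) ` Collect quasi_unitary)" for c
  proof -
    have "cmod (f (s * c)) \<le> K * (2 * norm c)" if "quasi_unitary s" for s
    proof -
      have "norm (s * c) \<le> 2 * norm c"
        using norm_mult_ineq [of s c] quasi_unitary_norm_le [OF that]
        by (meson mult_right_mono norm_ge_zero order_trans)
      then show ?thesis
        using f'(4) [of "s * c"] mult_left_mono [OF _ f'(1)] order_trans by blast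
    qed
    then show ?thesis
      by (auto simp: bounded_iff)
  qed
  \<comment> \<open>By linearity in c and \<open>quasi_unitary_span\<close> only quasi-unitary c
    have to be checked.\<close>
  have "complex_vec.subspace {c. \<Lambda> (\<lambda>s. f (s * c)) = - f c}"
  proof (rule complex_vec.subspaceI)
    have "f 0 = 0"
      using f'(3) [of 0 0] by simp
    then show "0 \<in> {c. \<Lambda> (\<lambda>s. f (s * c)) = - f c}"
      by (simp add: mean_on_const [OF \<Lambda>])
  qed (simp_all add: distrib_left f' mean_on_add [OF \<Lambda>] mean_on_scale [OF \<Lambda>] bd scaleC_mult_right)
  moreover have "Collect quasi_unitary \<subseteq> {c. \<Lambda> (\<lambda>s. f (s * c)) = - f c}"
  proof clarify
    fix v :: 'a assume v: "quasi_unitary v"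
    have bf: "bounded (f ` Collect quasi_unitary)"
    proof -
      have "cmod (f s) \<le> K * 2" if "quasi_unitary s" for s
        using f'(4) [of s] mult_left_mono [OF quasi_unitary_norm_le [OF that] f'(1)] by simp
      then show ?thesis
        by (auto simp: bounded_iff)
    qed
    \<comment> \<open>By invariance \<open>f (v \<odot> s)\<close> and \<open>f s\<close> have the
      same mean; they cancel and leave \<open>- f v\<close>.\<close>
    have "f (s * v) = f (v \<odot> s) - (f s + f v)" for s
      by (simp add: circle_def f' comm [rule_format, of s])
    moreover have "bounded ((\<lambda>s. f (v \<odot> s)) ` Collect quasi_unitary)"
      using bf quasi_unitary_circle [OF v] by (auto simp: bounded_iff)
    moreover have "bounded ((\<lambda>s. f s + f v) ` Collect quasi_unitary)" "bounded ((\<lambda>s::'a. f v) ` Collect quasi_unitary)"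
      using bf by (simp_all add: bounded_image_add image_constant_conv)
    ultimately show "\<Lambda> (\<lambda>s. f (s * v)) = - f v"
      using bf v by (simp add: mean_on_diff [OF \<Lambda>] mean_on_add [OF \<Lambda>] mean_on_const [OF \<Lambda>] inv)
  qed
  ultimately have "cspan (Collect quasi_unitary) \<subseteq> {c. \<Lambda> (\<lambda>s. f (s * c)) = - f c}"
    by (intro complex_vec.span_minimal)
  then show ?thesis
    by (auto simp: quasi_unitary_span)
qed

text \<open>In the notation of the unitization this averages \<open>(1 + s) p \<otimes> q (1 + s)\<^sup>*\<close>.\<close>

definition diagonal_point :: "'a \<times> 'a \<times> 'a \<Rightarrow> 'a \<times> 'a" where
  "diagonal_point = (\<lambda>(p, q, s). (p + s * p, q + star s * q))"

text \<open>The means over p and q lead from the unitization back to A: - p and - q act as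
  approximate identities in the mean, and the two signs cancel.\<close>

definition commutative_diagonal :: "('a \<Rightarrow> 'a \<Rightarrow> complex) \<Rightarrow> complex" where
  "commutative_diagonal S = \<Lambda> (\<lambda>p. \<Lambda> (\<lambda>q. \<Lambda> (\<lambda>s. case diagonal_point (p, q, s) of (a, b) \<Rightarrow> S a b)))"

abbreviation quasi_unitaries :: "'a set" where
  "quasi_unitaries \<equiv> Collect quasi_unitary"

lemma commutative_mean:
  "mean_on (quasi_unitaries \<times> quasi_unitaries \<times> quasi_unitaries) (\<lambda>F. \<Lambda> (\<lambda>p. \<Lambda> (\<lambda>q. \<Lambda> (\<lambda>s. F (p, q, s)))))"
  by (rule mean_on_prod [OF \<Lambda> mean_on_prod [OF \<Lambda> \<Lambda>]])

text \<open>4 is 2 * 2: the two components have the norms of p and q, each at most 2.\<close>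

lemma diagonal_point_bound:
  assumes S: "bounded_form self_algebra S K"
    and z: "z \<in> quasi_unitaries \<times> quasi_unitaries \<times> quasi_unitaries"
  shows "cmod (case diagonal_point z of (a, b) \<Rightarrow> S a b) \<le> 4 * K"
proof -
  obtain p q s where z': "z = (p, q, s)" "quasi_unitary p" "quasi_unitary q" "quasi_unitary s"
    using z by auto
  have n: "norm (p + s * p) \<le> 2" "norm (q + star s * q) \<le> 2"
    using z' by (simp_all add: quasi_unitary_norm quasi_unitary_star quasi_unitary_norm_le)
  have "cmod (S (p + s * p) (q + star s * q)) \<le> K * norm (p + s * p) * norm (q + star s * q)"
    using bounded_formD(6) [OF S] by simp
  also have "\<dots> \<le> K * 2 * 2"
    by (intro mult_mono n bounded_formD(1) [OF S] order.refl mult_nonneg_nonneg) auto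
  finally show ?thesis
    by (simp add: z' diagonal_point_def)
qed

lemma diagonal_point_bounded:
  "bounded_form self_algebra S K \<Longrightarrow>
    bounded ((\<lambda>z. case diagonal_point z of (a, b) \<Rightarrow> S a b) ` (quasi_unitaries \<times> quasi_unitaries \<times> quasi_unitaries))"
  using diagonal_point_bound unfolding bounded_iff by blast

lemma commutative_diagonal_bound:
  "bounded_form self_algebra S K \<Longrightarrow> cmod (commutative_diagonal S) \<le> 4 * K"
  unfolding commutative_diagonal_def
  by (rule mean_on_bound [OF commutative_mean diagonal_point_bound])

lemma commutative_diagonal_add:
  assumes "bounded_form self_algebra S K" "bounded_form self_algebra S' K'"
  shows "commutative_diagonal (\<lambda>a b. S a b + S' a b) = commutative_diagonal S + commutative_diagonal S'"
  using mean_on_add [OF commutative_mean diagonal_point_bounded [OF assms(1)] diagonal_point_bounded [OF assms(2)]]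
  by (simp add: commutative_diagonal_def case_prod_unfold)

lemma commutative_diagonal_scale:
  assumes "bounded_form self_algebra S K"
  shows "commutative_diagonal (\<lambda>a b. c * S a b) = c * commutative_diagonal S"
  using mean_on_scale [OF commutative_mean diagonal_point_bounded [OF assms]]
  by (simp add: commutative_diagonal_def case_prod_unfold)

text \<open>By linearity c may be a quasi-unitary v. With 1 + v in place of v the identity is
  translation invariance in s for fixed p and q; the contribution of 1 is then cancelled.\<close>

lemma commutative_diagonal_swap:
  assumes S: "bounded_form self_algebra S K"
  shows "commutative_diagonal (\<lambda>a b. S (c * a) b) = commutative_diagonal (\<lambda>a b. S a (b * c))"
proof -
  note left = A.bounded_form_mult_left [OF S, simplified]
    and right = A.bounded_form_mult_right [OF S, simplified]
  note S' = bounded_formD [OF S, simplified]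
  have S_left: "S (a + b) = (\<lambda>d. S a d + S b d)" "S (k *\<^sub>C a) = (\<lambda>d. k * S a d)" for a b k
    using S' by auto
  let ?E = "{c. commutative_diagonal (\<lambda>a b. S (c * a) b) = commutative_diagonal (\<lambda>a b. S a (b * c))}"
  have "complex_vec.subspace ?E"
  proof (rule complex_vec.subspaceI)
    have "S 0 = (\<lambda>b. 0)" "\<And>a. S a 0 = 0"
      using S'(4) [of 0 0] S'(5) [of _ 0 0] by (simp_all add: fun_eq_iff)
    then show "0 \<in> ?E"
      by simp
  next
    fix c d assume "c \<in> ?E" "d \<in> ?E"
    then show "c + d \<in> ?E"
      by (simp add: distrib_left distrib_right S_left S'(3) commutative_diagonal_add [OF left left]
          commutative_diagonal_add [OF right right])
  next
    fix k c assume "c \<in> ?E"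
    then show "k *\<^sub>C c \<in> ?E"
      by (simp add: scaleC_mult_left scaleC_mult_right S_left S'(5) commutative_diagonal_scale [OF left]
          commutative_diagonal_scale [OF right])
  qed
  moreover have "quasi_unitaries \<subseteq> ?E"
  proof clarify
    fix v :: 'a assume v: "quasi_unitary v"
    have vv: "star v + (v + v * star v) = 0"
      using v by (simp add: quasi_unitary_def add.assoc)
    have "\<Lambda> (\<lambda>s. S ((p + s * p) + v * (p + s * p)) (q + star s * q)) =
        \<Lambda> (\<lambda>s. S (p + s * p) ((q + star s * q) + (q + star s * q) * v))" for p q
    proof -
      \<comment> \<open>The integrand of the right side. Replacing s by \<open>v \<odot> s\<close>
        gives that of the left side, because star (1 + v) and 1 + v cancel in the second
        slot.\<close>
      define G where "G s = S (p + s * p) ((q + star s * q) + (q + star s * q) * v)" for s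
      have "cmod (G s) \<le> K * norm p * (norm q + norm q * norm v)" if "quasi_unitary s" for s
      proof -
        have 1: "norm (p + s * p) = norm p" "norm (q + star s * q) = norm q"
          using that by (simp_all add: quasi_unitary_norm quasi_unitary_star)
        have "cmod (G s) \<le> K * norm p * norm ((q + star s * q) + (q + star s * q) * v)"
          using S'(6) [of "p + s * p" "(q + star s * q) + (q + star s * q) * v"] by (simp only: G_def 1)
        also have "\<dots> \<le> K * norm p * (norm q + norm q * norm v)"
          using 1(2) norm_triangle_ineq [of "q + star s * q" "(q + star s * q) * v"]
            norm_mult_ineq [of "q + star s * q" v]
          by (intro mult_left_mono mult_nonneg_nonneg S') auto
        finally show ?thesis .
      qed
      then have "bounded (G ` quasi_unitaries)"
        unfolding bounded_iff by blast
      have "S ((p + s * p) + v * (p + s * p)) (q + star s * q) = G (v \<odot> s)" for s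
      proof -
        have 1: "(p + s * p) + v * (p + s * p) = p + (v \<odot> s) * p"
          by (simp add: circle_def algebra_simps)
        define x where "x = q + star s * q"
        have "star (v \<odot> s) = star v + star s + star v * star s"
          by (simp add: circle_def star_add star_mult comm [rule_format, of "star s" "star v"])
        then have "q + star (v \<odot> s) * q = x + star v * x"
          by (simp add: x_def algebra_simps)
        moreover have "(x + star v * x) * v = v * (x + star v * x)"
          by (rule comm [rule_format])
        ultimately have "(q + star (v \<odot> s) * q) + (q + star (v \<odot> s) * q) * v =
            x + (star v + (v + v * star v)) * x"
          by (simp add: algebra_simps)
        then have 2: "(q + star (v \<odot> s) * q) + (q + star (v \<odot> s) * q) * v = q + star s * q"
          by (simp add: vv x_def)
        show ?thesis
          unfolding G_def 2 1 ..
      qed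
      then have "\<Lambda> (\<lambda>s. S ((p + s * p) + v * (p + s * p)) (q + star s * q)) = \<Lambda> (\<lambda>s. G (v \<odot> s))"
        by simp
      also have "\<dots> = \<Lambda> G"
        using v \<open>bounded (G ` quasi_unitaries)\<close> by (rule inv)
      finally show ?thesis
        by (simp add: G_def [abs_def])
    qed
    then have "commutative_diagonal (\<lambda>a b. S (a + v * a) b) = commutative_diagonal (\<lambda>a b. S a (b + b * v))"
      by (simp add: commutative_diagonal_def diagonal_point_def)
    then show "commutative_diagonal (\<lambda>a b. S (v * a) b) = commutative_diagonal (\<lambda>a b. S a (b * v))"
      by (simp add: S_left S'(3) commutative_diagonal_add [OF S left] commutative_diagonal_add [OF S right])
  qed
  ultimately have "cspan quasi_unitaries \<subseteq> ?E"
    by (intro complex_vec.span_minimal)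
  then show ?thesis
    by (auto simp: quasi_unitary_span)
qed

text \<open>(1 + s) p q star (1 + s) equals p q for every quasi-unitary s, so only the means over q
  and p remain, and each contributes a sign by \<open>mean_quasi_unitary\<close>.\<close>

lemma commutative_diagonal_unit:
  assumes f: "bounded_functional self_algebra f K"
  shows "commutative_diagonal (\<lambda>a b. f (a * b * c)) = f c"
proof -
  note form = A.bounded_functional_mult_form [OF A.bounded_functional_mult_right [OF f], of c, simplified]
  have "(p + s * p) * (q + star s * q) = p * q" if "quasi_unitary s" for p q s :: 'a
  proof -
    have "(p + s * p) * (q + star s * q) = p * q + (star s + s + s * star s) * (p * q)"
      by (simp add: distrib_left distrib_right add_ac mult.assoc comm [rule_format, of p]
          mult_left_comm [of p])
    then show ?thesis
      using that by (simp add: quasi_unitary_def)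
  qed
  then have "commutative_diagonal (\<lambda>a b. f (a * b * c)) = \<Lambda> (\<lambda>p. \<Lambda> (\<lambda>q. \<Lambda> (\<lambda>s. f (p * q * c))))"
    unfolding commutative_diagonal_def
    using mean_on_cong [OF commutative_mean diagonal_point_bounded [OF form],
        where f' = "\<lambda>(p, q, s). f (p * q * c)"]
    by (fastforce simp: diagonal_point_def)
  also have "\<dots> = \<Lambda> (\<lambda>p. \<Lambda> (\<lambda>q. f (q * (p * c))))"
    by (simp add: mean_on_const [OF \<Lambda>] mult.assoc mult_left_comm)
  also have "\<dots> = - \<Lambda> (\<lambda>p. f (p * c))"
  proof -
    have "bounded_functional self_algebra (\<lambda>x. - f x) K"
      using f by (simp add: bounded_functional_def)
    from mean_quasi_unitary [OF this, of c] mean_quasi_unitary [OF f] show ?thesis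
      by simp
  qed
  finally show ?thesis
    by (simp add: mean_quasi_unitary [OF f])
qed

lemma virtual_diagonal_commutative: "virtual_diagonal self_algebra commutative_diagonal"
proof -
  have "commutative_diagonal (\<lambda>a b. f (c * (a * b))) = f c"
    if "bounded_functional self_algebra f K" for f K c
    using commutative_diagonal_unit [OF that, of c] by (simp add: comm [rule_format, of c])
  then show ?thesis
    unfolding virtual_diagonal_def
    using commutative_diagonal_bound commutative_diagonal_add commutative_diagonal_scale
      commutative_diagonal_swap commutative_diagonal_unit
    by (auto intro!: exI [of _ 4])
qed

end

theorem commutative_virtual_diagonal: "\<exists>M. virtual_diagonal (self_algebra :: 'a normed_alg) M"
  by (rule quasi_unitary_mean) (blast intro: virtual_diagonal_commutative)

end

section \<open>Finite-dimensional C*-algebras\<close>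

lemma scaleC_linear_sum:
  fixes \<phi> :: "'a::complex_banach \<Rightarrow> complex"
  assumes "\<And>x y. \<phi> (x + y) = \<phi> x + \<phi> y" "\<And>c x. \<phi> (c *\<^sub>C x) = c * \<phi> x"
  shows "\<phi> (\<Sum>i\<in>I. k i *\<^sub>C x i) = (\<Sum>i\<in>I. k i * \<phi> (x i))"
proof -
  have "\<phi> 0 = 0"
    using assms(2) [of 0 0] by simp
  then show ?thesis
    by (induction I rule: infinite_finite_induct) (simp_all add: assms)
qed

definition ctrace :: "'a::complex_banach set \<Rightarrow> ('a \<Rightarrow> 'a) \<Rightarrow> complex" where
  "ctrace Bs F = (\<Sum>b\<in>Bs. complex_vec.representation Bs (F b) b)"

definition complex_basis :: "'a::complex_banach set \<Rightarrow> bool" where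
  "complex_basis Bs \<longleftrightarrow> finite Bs \<and> complex_vec.independent Bs \<and> cspan Bs = UNIV"

lemma complex_basis_representation:
  assumes "complex_basis Bs"
  shows representation_add: "complex_vec.representation Bs (x + y) b =
      complex_vec.representation Bs x b + complex_vec.representation Bs y b"
    and representation_scaleC: "complex_vec.representation Bs (c *\<^sub>C x) b =
      c * complex_vec.representation Bs x b"
    and representation_basis: "b \<in> Bs \<Longrightarrow> complex_vec.representation Bs b d = (if d = b then 1 else 0)"
    and sum_representation: "(\<Sum>b\<in>Bs. complex_vec.representation Bs x b *\<^sub>C b) = x"
  using assms
  by (simp_all add: complex_basis_def complex_vec.representation_add complex_vec.representation_scale
      complex_vec.representation_basis complex_vec.sum_representation_eq)

lemma representation_expand:
  assumes Bs: "complex_basis Bs"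
    and "\<And>x y. F (x + y) = F x + F y" "\<And>c x. F (c *\<^sub>C x) = c *\<^sub>C F x"
    and Cs: "complex_basis Cs"
  shows "complex_vec.representation Cs (F x) d =
    (\<Sum>b\<in>Bs. complex_vec.representation Bs x b * complex_vec.representation Cs (F b) d)"
  using scaleC_linear_sum [of "\<lambda>x. complex_vec.representation Cs (F x) d"
      "complex_vec.representation Bs x" "\<lambda>b. b" Bs]
  by (simp add: sum_representation [OF Bs] assms(2,3) representation_add [OF Cs]
      representation_scaleC [OF Cs])

lemma ctrace_commute:
  assumes Bs: "complex_basis Bs" and Cs: "complex_basis Cs"
    and F: "\<And>x y. F (x + y) = F x + F y" "\<And>c x. F (c *\<^sub>C x) = c *\<^sub>C F x"
    and G: "\<And>x y. G (x + y) = G x + G y" "\<And>c x. G (c *\<^sub>C x) = c *\<^sub>C G x"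
  shows "ctrace Bs (\<lambda>x. F (G x)) = ctrace Cs (\<lambda>x. G (F x))"
proof -
  let ?B = "complex_vec.representation Bs" and ?C = "complex_vec.representation Cs"
  have "ctrace Bs (\<lambda>x. F (G x)) = (\<Sum>b\<in>Bs. \<Sum>c\<in>Cs. ?C (G b) c * ?B (F c) b)"
    by (simp add: ctrace_def representation_expand [OF Cs F Bs, of "G _"])
  also have "\<dots> = (\<Sum>c\<in>Cs. \<Sum>b\<in>Bs. ?B (F c) b * ?C (G b) c)"
    by (subst sum.swap) (simp add: mult.commute)
  also have "\<dots> = ctrace Cs (\<lambda>x. G (F x))"
    by (simp add: ctrace_def representation_expand [OF Bs G Cs, of "F _"])
  finally show ?thesis .
qed

context
  fixes Bs :: "'a::cstar_algebra set"
  assumes Bs: "complex_basis Bs"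
begin

interpretation fd: finite_dimensional_vector_space "scaleC :: complex \<Rightarrow> 'a \<Rightarrow> 'a" Bs
  using Bs unfolding complex_basis_def cspan_def by unfold_locales auto

definition reg_trace :: "'a \<Rightarrow> complex" where
  "reg_trace a = ctrace Bs (\<lambda>x. a * x)"

lemma reg_trace_add: "reg_trace (a + b) = reg_trace a + reg_trace b"
  by (simp add: reg_trace_def ctrace_def distrib_right representation_add [OF Bs] sum.distrib)

lemma reg_trace_scaleC: "reg_trace (c *\<^sub>C a) = c * reg_trace a"
  by (simp add: reg_trace_def ctrace_def scaleC_mult_left representation_scaleC [OF Bs] sum_distrib_left)

lemma reg_trace_zero [simp]: "reg_trace 0 = 0"
  using reg_trace_scaleC [of 0 0] by simp

lemma reg_trace_diff: "reg_trace (a - b) = reg_trace a - reg_trace b"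
  using reg_trace_add [of "a - b" b] by simp

lemma reg_trace_commute: "reg_trace (a * b) = reg_trace (b * a)"
  using ctrace_commute [OF Bs Bs, of "\<lambda>x. a * x" "\<lambda>x. b * x"]
  by (simp add: reg_trace_def distrib_left scaleC_mult_right mult.assoc)

text \<open>The trace of an idempotent is its rank, computed in a basis that extends a basis of the range.\<close>

lemma reg_trace_idempotent:
  assumes e: "e * e = e" "e \<noteq> 0"
  shows "reg_trace e \<noteq> 0"
proof -
  obtain C where C: "C \<subseteq> range ((*) e)" "complex_vec.independent C" "range ((*) e) \<subseteq> cspan C"
    using complex_vec.maximal_independent_subset [of "range ((*) e)"] by blast
  obtain C' where C': "C \<subseteq> C'" "complex_vec.independent C'" "UNIV \<subseteq> cspan C'"
    by (rule complex_vec.maximal_independent_subset_extend [OF subset_UNIV C(2)])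
  then have span: "cspan C' = UNIV"
    by blast
  have basis: "complex_basis C'"
    using C'(2) span fd.finiteI_independent by (simp add: complex_basis_def)
  \<comment> \<open>e fixes C and maps everything into its span, so its matrix has diagonal entry 1
    on C and 0 elsewhere.\<close>
  have "complex_vec.representation C' (e * b) b = (if b \<in> C then 1 else 0)" if "b \<in> C'" for b
  proof (cases "b \<in> C")
    case True
    then have "e * b = b"
      using C(1) e(1) by (auto simp flip: mult.assoc)
    then show ?thesis
      using True that by (simp add: representation_basis [OF basis])
  next
    case False
    have "complex_vec.representation C' (e * b) = complex_vec.representation C (e * b)"
      using C(3) C'(1,2) by (intro complex_vec.representation_extend) auto
    then show ?thesis
      using False complex_vec.representation_ne_zero [of C "e * b" b] by auto
  qed
  then have "ctrace C' ((*) e) = (\<Sum>b\<in>C'. if b \<in> C then 1 else 0)"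
    by (simp add: ctrace_def)
  also have "\<dots> = of_nat (card C)"
    using basis C'(1) by (simp add: complex_basis_def sum.If_cases Int_absorb1)
  finally have "ctrace C' ((*) e) = of_nat (card C)" .
  moreover have "ctrace C' ((*) e) = reg_trace e"
    using ctrace_commute [OF Bs basis, of "\<lambda>x. x" "(*) e"]
    by (simp add: reg_trace_def distrib_left scaleC_mult_right)
  moreover have "C \<noteq> {}"
    using C(3) e by (auto simp: image_subset_iff dest: spec [of _ e])
  moreover have "finite C"
    using C(2) fd.finiteI_independent by blast
  ultimately show ?thesis
    by (metis card_gt_0_iff of_nat_eq_0_iff less_numeral_extra(3))
qed

section \<open>The trace form and its Casimir element\<close>

definition right_ideal :: "'a set \<Rightarrow> bool" where
  "right_ideal R \<longleftrightarrow> complex_vec.subspace R \<and> (\<forall>x\<in>R. \<forall>y. x * y \<in> R)"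

text \<open>Brauer's lemma: if the radical of the trace form were nonzero, a minimal right ideal in it
  would be generated by an idempotent, which has nonzero trace.\<close>

lemma reg_trace_nondegenerate:
  assumes "\<And>y. reg_trace (x * y) = 0"
  shows "x = 0"
proof (rule ccontr)
  assume "x \<noteq> 0"
  define J where "J = {x. \<forall>y. reg_trace (x * y) = 0}"
  have "right_ideal J"
    unfolding right_ideal_def
  proof (intro conjI complex_vec.subspaceI)
    show "0 \<in> J"
      by (simp add: J_def)
  qed (auto simp: J_def distrib_right reg_trace_add scaleC_mult_left reg_trace_scaleC mult.assoc)
  moreover have "J \<noteq> {0}"
    using assms \<open>x \<noteq> 0\<close> by (auto simp: J_def)
  ultimately obtain R where R: "right_ideal R" "R \<subseteq> J" "R \<noteq> {0}"
    and min: "\<And>R'. right_ideal R' \<Longrightarrow> R' \<subseteq> J \<Longrightarrow> R' \<noteq> {0} \<Longrightarrow> complex_vec.dim R \<le> complex_vec.dim R'"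
    using ex_has_least_nat [of "\<lambda>R. right_ideal R \<and> R \<subseteq> J \<and> R \<noteq> {0}" J complex_vec.dim] by auto
  have minimal: "R' = R" if "right_ideal R'" "R' \<subseteq> R" "R' \<noteq> {0}" for R'
    using that R min [of R'] by (intro fd.subspace_dim_equal) (auto simp: right_ideal_def)
  have sub: "complex_vec.subspace R" and ideal: "\<And>x y. x \<in> R \<Longrightarrow> x * y \<in> R"
    using R(1) by (auto simp: right_ideal_def)
  have "0 \<in> R"
    using complex_vec.subspace_0 [OF sub] .
  then obtain a where a: "a \<in> R" "a \<noteq> 0"
    using R(3) by blast
  \<comment> \<open>A nonzero selfadjoint element has nonzero square by the C*-identity; this
    excludes the alternative R R = 0 in Brauer's lemma.\<close>
  define h where "h = a * star a"
  have h: "h \<in> R" "star h = h" "h \<noteq> 0"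
    using ideal [OF a(1)] a(2) norm_star_mult [of "star a"]
    by (auto simp: h_def star_mult star_star)
  have "norm (h * h) = (norm h)\<^sup>2"
    using norm_star_mult [of h] h(2) by simp
  then have "h * h \<noteq> 0"
    using h(3) by auto
  \<comment> \<open>h R lies in R and contains h h, so minimality gives h R = R and thereby an e in
    R with h e = h.\<close>
  have "right_ideal ((*) h ` R)"
    unfolding right_ideal_def
  proof (intro conjI ballI allI)
    show "complex_vec.subspace ((*) h ` R)"
    proof (rule complex_vec.subspaceI)
      show "0 \<in> (*) h ` R"
        using \<open>0 \<in> R\<close> by (auto intro!: image_eqI [of _ _ 0])
      show "u + v \<in> (*) h ` R" if "u \<in> (*) h ` R" "v \<in> (*) h ` R" for u v
        using that complex_vec.subspace_add [OF sub] by (auto simp flip: distrib_left)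
      show "c *\<^sub>C u \<in> (*) h ` R" if "u \<in> (*) h ` R" for c u
        using that complex_vec.subspace_scale [OF sub] by (auto simp flip: scaleC_mult_right)
    qed
    show "u * y \<in> (*) h ` R" if "u \<in> (*) h ` R" for u y
      using that ideal by (auto simp: mult.assoc)
  qed
  then have "(*) h ` R = R"
    using h(1) \<open>h * h \<noteq> 0\<close> ideal by (intro minimal) auto
  then obtain e where e: "e \<in> R" "h * e = h"
    using h(1) by (metis imageE)
  \<comment> \<open>The annihilator of h in R misses e, so it is zero by minimality; it contains e e
    - e.\<close>
  have "right_ideal {x \<in> R. h * x = 0}"
    unfolding right_ideal_def
  proof (intro conjI complex_vec.subspaceI)
    show "\<forall>x\<in>{x \<in> R. h * x = 0}. \<forall>y. x * y \<in> {x \<in> R. h * x = 0}"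
      using ideal by (auto simp flip: mult.assoc)
  qed (use \<open>0 \<in> R\<close> sub in \<open>auto simp: distrib_left scaleC_mult_right complex_vec.subspace_add
      complex_vec.subspace_scale\<close>)
  moreover have "e \<notin> {x \<in> R. h * x = 0}"
    using e h(3) by simp
  then have "{x \<in> R. h * x = 0} \<noteq> R"
    using e(1) by metis
  ultimately have "{x \<in> R. h * x = 0} = {0}"
    using minimal by blast
  moreover have "e * e - e \<in> R"
    using e(1) ideal complex_vec.subspace_diff [OF sub] by blast
  moreover have "h * (e * e - e) = 0"
    by (simp add: right_diff_distrib e(2) flip: mult.assoc)
  ultimately have "e * e - e = 0"
    by blast
  then have "e * e = e"
    by simp
  moreover have "e \<noteq> 0"
    using e h(3) by auto
  moreover have "reg_trace (e * e) = 0"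
    using e(1) R(2) by (auto simp: J_def)
  ultimately show False
    using reg_trace_idempotent by simp
qed

text \<open>f is the basis dual to Bs for the trace form: nondegeneracy makes x \<mapsto>
  \<open>reg_trace (_ * x)\<close> injective, hence bijective in finite dimension, and
  \<open>f e\<close> is the preimage of the coordinate functional of e.\<close>

lemma reg_trace_dual_basis:
  obtains f where "\<And>x e. e \<in> Bs \<Longrightarrow> complex_vec.representation Bs x e = reg_trace (x * f e)"
    and "\<And>x. (\<Sum>e\<in>Bs. reg_trace (e * x) *\<^sub>C f e) = x"
proof -
  \<comment> \<open>The functional \<open>reg_trace (_ * x)\<close>, encoded by its values on Bs as
    coordinates, so that \<open>\<Phi>\<close> is an endomorphism.\<close>
  define \<Phi> where "\<Phi> x = (\<Sum>e\<in>Bs. reg_trace (e * x) *\<^sub>C e)" for x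
  have \<Phi>_add: "\<Phi> (x + y) = \<Phi> x + \<Phi> y" for x y
    by (simp add: \<Phi>_def distrib_left reg_trace_add scaleC_add_left sum.distrib)
  have \<Phi>_scale: "\<Phi> (c *\<^sub>C x) = c *\<^sub>C \<Phi> x" for c x
    by (simp add: \<Phi>_def scaleC_mult_right reg_trace_scaleC complex_vec.scale_sum_right scaleC_scaleC)
  have lin: "Vector_Spaces.linear scaleC scaleC \<Phi>"
    by (simp add: Vector_Spaces.linear_iff complex_vec.vector_space_axioms \<Phi>_add \<Phi>_scale)
  have coeff: "complex_vec.representation Bs (\<Phi> x) e = reg_trace (e * x)" if e: "e \<in> Bs" for x e
  proof -
    have "finite Bs"
      using Bs by (simp add: complex_basis_def)
    have "complex_vec.representation Bs (\<Phi> x) e =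
        (\<Sum>d\<in>Bs. reg_trace (d * x) * complex_vec.representation Bs d e)"
      unfolding \<Phi>_def
      by (rule scaleC_linear_sum) (simp_all add: representation_add [OF Bs] representation_scaleC [OF Bs])
    also have "\<dots> = (\<Sum>d\<in>Bs. if d = e then reg_trace (d * x) else 0)"
      by (intro sum.cong) (auto simp: representation_basis [OF Bs])
    also have "\<dots> = reg_trace (e * x)"
      using e \<open>finite Bs\<close> by simp
    finally show ?thesis .
  qed
  have expand: "reg_trace (y * x) = (\<Sum>e\<in>Bs. complex_vec.representation Bs y e * reg_trace (e * x))" for x y
    using scaleC_linear_sum [of "\<lambda>y. reg_trace (y * x)" "complex_vec.representation Bs y" "\<lambda>e. e" Bs]
    by (simp add: distrib_right reg_trace_add scaleC_mult_left reg_trace_scaleC sum_representation [OF Bs])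
  have inj: "inj \<Phi>"
  proof (rule injI)
    fix x y assume "\<Phi> x = \<Phi> y"
    then have "reg_trace (e * x) = reg_trace (e * y)" if "e \<in> Bs" for e
      using coeff [OF that] by metis
    then have "reg_trace (z * x) = reg_trace (z * y)" for z
      by (simp add: expand [of z x] expand [of z y])
    then have "reg_trace ((x - y) * z) = 0" for z
      by (simp add: reg_trace_commute [of "x - y"] right_diff_distrib reg_trace_diff)
    then show "x = y"
      using reg_trace_nondegenerate by fastforce
  qed
  then have "surj \<Phi>"
    using fd.linear_inj_imp_surj [OF lin] by blast
  then obtain f where f: "\<And>e. \<Phi> (f e) = e"
    by (metis surjD)
  show thesis
  proof (rule that [of f])
    have dual: "reg_trace (d * f e) = (if d = e then 1 else 0)" if "d \<in> Bs" "e \<in> Bs" for d e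
      using coeff [OF that(1), of "f e"] that by (simp add: f representation_basis [OF Bs])
    show "complex_vec.representation Bs x e = reg_trace (x * f e)" if "e \<in> Bs" for x e
    proof -
      have "finite Bs"
        using Bs by (simp add: complex_basis_def)
      have "reg_trace (x * f e) = (\<Sum>d\<in>Bs. if d = e then complex_vec.representation Bs x d else 0)"
        unfolding expand [of x "f e"] using that by (intro sum.cong) (auto simp: dual)
      then show ?thesis
        using that \<open>finite Bs\<close> by simp
    qed
    show "(\<Sum>e\<in>Bs. reg_trace (e * x) *\<^sub>C f e) = x" for x
    proof (rule injD [OF inj])
      have "\<Phi> 0 = 0"
        using \<Phi>_scale [of 0 0] by simp
      then have "\<Phi> (\<Sum>e\<in>I. k e *\<^sub>C f e) = (\<Sum>e\<in>I. k e *\<^sub>C e)" for I k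
        by (induction I rule: infinite_finite_induct) (simp_all add: \<Phi>_add \<Phi>_scale f)
      then show "\<Phi> (\<Sum>e\<in>Bs. reg_trace (e * x) *\<^sub>C f e) = \<Phi> x"
        by (simp add: \<Phi>_def)
    qed
  qed
qed

text \<open>The Casimir element of the trace form is a diagonal.\<close>

lemma basis_virtual_diagonal: "\<exists>M. virtual_diagonal (self_algebra :: 'a normed_alg) M"
proof -
  obtain f where rep: "\<And>x e. e \<in> Bs \<Longrightarrow> complex_vec.representation Bs x e = reg_trace (x * f e)"
    and dual: "\<And>x. (\<Sum>e\<in>Bs. reg_trace (e * x) *\<^sub>C f e) = x"
    using reg_trace_dual_basis by blast
  have basis: "(\<Sum>e\<in>Bs. reg_trace (x * f e) *\<^sub>C e) = x" for x
    using sum_representation [OF Bs, of x] by (simp add: rep)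
  \<comment> \<open>The image of the Casimir element under multiplication; it will be the unit of
    A.\<close>
  define z where "z = (\<Sum>e\<in>Bs. e * f e)"
  have z: "reg_trace (a * z) = reg_trace a" for a
  proof -
    \<comment> \<open>\<open>reg_trace (a * e * f e)\<close> is the diagonal entry at e of left
      multiplication by a.\<close>
    have "reg_trace (a * z) = (\<Sum>e\<in>Bs. reg_trace (a * e * f e))"
      using scaleC_linear_sum [of "\<lambda>y. reg_trace (a * y)" "\<lambda>_. 1" "\<lambda>e. e * f e" Bs]
      by (simp add: z_def distrib_left reg_trace_add scaleC_mult_right reg_trace_scaleC mult.assoc)
    also have "\<dots> = ctrace Bs (\<lambda>x. a * x)"
      by (simp add: rep ctrace_def)
    also have "\<dots> = reg_trace a"
      by (simp add: reg_trace_def)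
    finally show ?thesis .
  qed
  have "z * x - x = 0" for x
  proof (rule reg_trace_nondegenerate)
    have "reg_trace (z * (x * y)) = reg_trace (x * y)" for y
      by (simp only: reg_trace_commute [of z] z)
    then show "reg_trace ((z * x - x) * y) = 0" for y
      by (simp add: left_diff_distrib reg_trace_diff mult.assoc)
  qed
  then have z_left: "z * x = x" for x
    by simp
  have "x * z - x = 0" for x
    by (rule reg_trace_nondegenerate) (simp add: left_diff_distrib mult.assoc z_left)
  then have z_right: "x * z = x" for x
    by simp
  define C where "C = (\<Sum>e\<in>Bs. norm e * norm (f e))"
  define M where "M S = (\<Sum>e\<in>Bs. S e (f e))" for S :: "'a \<Rightarrow> 'a \<Rightarrow> complex"
  have "virtual_diagonal self_algebra M"
    unfolding virtual_diagonal_def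
  proof (intro conjI allI impI ballI exI [of _ C])
    show "0 \<le> C"
      by (simp add: C_def sum_nonneg)
  next
    fix S :: "'a \<Rightarrow> 'a \<Rightarrow> complex" and K assume S: "bounded_form self_algebra S K"
    have "cmod (M S) \<le> (\<Sum>e\<in>Bs. K * norm e * norm (f e))"
      unfolding M_def using bounded_formD(6) [OF S] by (intro order.trans [OF norm_sum] sum_mono) simp
    also have "\<dots> = C * K"
      by (simp add: C_def sum_distrib_left mult_ac)
    finally show "cmod (M S) \<le> C * K" .
  next
    fix S :: "'a \<Rightarrow> 'a \<Rightarrow> complex" and K c assume S: "bounded_form self_algebra S K"
    note S = bounded_formD [OF S, simplified]
    have left: "S (\<Sum>e\<in>Bs. k e *\<^sub>C x e) y = (\<Sum>e\<in>Bs. k e * S (x e) y)" for k x y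
      by (rule scaleC_linear_sum) (simp_all add: S)
    have right: "S y (\<Sum>e\<in>Bs. k e *\<^sub>C x e) = (\<Sum>e\<in>Bs. k e * S y (x e))" for k x y
      by (rule scaleC_linear_sum) (simp_all add: S)
    \<comment> \<open>\<open>c * e\<close> is expanded in Bs and \<open>f d * c\<close> in the dual
      basis; the coefficients agree by the trace property.\<close>
    have "M (\<lambda>a b. S (c * a) b) = (\<Sum>e\<in>Bs. \<Sum>d\<in>Bs. reg_trace (c * e * f d) * S d (f e))"
      unfolding M_def left [symmetric] basis ..
    also have "\<dots> = (\<Sum>d\<in>Bs. \<Sum>e\<in>Bs. reg_trace (e * (f d * c)) * S d (f e))"
      by (subst sum.swap) (simp add: mult.assoc reg_trace_commute [of c])
    also have "\<dots> = M (\<lambda>a b. S a (b * c))"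
      unfolding M_def right [symmetric] dual ..
    finally show "M (\<lambda>a b. S (na_mult self_algebra c a) b) = M (\<lambda>a b. S a (na_mult self_algebra b c))"
      by simp
  next
    fix g :: "'a \<Rightarrow> complex" and K c assume g: "bounded_functional self_algebra g K"
    note g = bounded_functionalD [OF g, simplified]
    have sum: "g (\<Sum>e\<in>Bs. x e) = (\<Sum>e\<in>Bs. g (x e))" for x
      using scaleC_linear_sum [of g "\<lambda>_. 1" x Bs] by (simp add: g)
    show "M (\<lambda>a b. g (na_mult self_algebra (na_mult self_algebra a b) c)) = g c"
      by (simp add: M_def sum [symmetric] sum_distrib_right [symmetric] z_def [symmetric] z_left)
    show "M (\<lambda>a b. g (na_mult self_algebra c (na_mult self_algebra a b))) = g c"
      by (simp add: M_def sum [symmetric] sum_distrib_left [symmetric] z_def [symmetric] z_right)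
  qed (simp_all add: M_def sum.distrib sum_distrib_left)
  then show ?thesis
    by blast
qed

end

theorem finite_dimensional_virtual_diagonal:
  assumes "finite S" "cspan S = (UNIV :: 'a::cstar_algebra set)"
  shows "\<exists>M. virtual_diagonal (self_algebra :: 'a normed_alg) M"
proof -
  obtain Bs where "Bs \<subseteq> S" "complex_vec.independent Bs" "S \<subseteq> cspan Bs"
    using complex_vec.maximal_independent_subset by blast
  moreover from this have "cspan Bs = UNIV"
    using assms(2) complex_vec.span_minimal [OF _ complex_vec.subspace_span] by (metis top.extremum_uniqueI)
  ultimately have "complex_basis Bs"
    using assms(1) by (simp add: complex_basis_def finite_subset)
  then show ?thesis
    by (rule basis_virtual_diagonal)
qed

section \<open>Amenability of the crossed product\<close>

theorem theorem2p4:
  fixes \<alpha> :: "'g::group_add \<Rightarrow> 'a::cstar_algebra \<Rightarrow> 'a"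
  assumes "amenable_group TYPE('g)"
    and "(\<forall>x y :: 'a. x * y = y * x) \<or> (\<exists>S :: 'a set. finite S \<and> cspan S = UNIV)"
    and "cstar_action \<alpha>"
  shows "amenable_banach_algebra TYPE('e::complex_banach) (l1_algebra \<alpha>)"
proof -
  interpret cstar_system \<alpha>
    using assms(3) by unfold_locales
  obtain M where "virtual_diagonal (self_algebra :: 'a normed_alg) M"
    using assms(2) commutative_virtual_diagonal finite_dimensional_virtual_diagonal by blast
  with assms(1) show ?thesis
    by (rule amenable_crossed_product)
qed

end
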